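(* There exists a numerical constant $\kappa>0$ such that the following holds. Let $n\ge 1$ and let $\mu$ be a compactly supported probability measure on $\mathbb{R}^n$ whose support is not included in a hyperplane. Denote by $K$ the convex hull of the support of $\mu$ and assume that the ($\ell^2$-)diameter of $K$ is $\sqrt n$. Let $f:\mathbb{R}^n\to\mathbb{R}$ be continuously differentiable and let $V=\nabla f(K)$. Then $$\log\int e^{f}\,d\mu\;\le\;\sup_{y\in\mathbb{R}^n}\{f(y)-\Lambda^*_\mu(y)\}+\kappa\, n^{1/3} g(V)^{2/3},$$ where $g(V)=\mathbb{E}\sup_{\zeta\in V}\langle\zeta,\Gamma\rangle$ is the Gaussian mean-width of $V$, with $\Gamma$ a standard Gaussian vector in $\mathbb{R}^n$.
   Context: The logarithmic Laplace transform of $\mu$ is $\Lambda_\mu(\lambda)=\log\int e^{\langle\lambda,x\rangle}d\mu(x)$, $\lambda\in\mathbb{R}^n$, and its Legendre transform is $\Lambda^*_\mu(x)=\sup_{\lambda\in\mathbb{R}^n}\{\langle\lambda,x\rangle-\Lambda_\mu(\lambda)\}\in[0,+\infty]$. *)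

theory Defs
  imports "HOL-Probability.Probability"
begin

text \<open>
  The constant in the theorem must not depend on the dimension, so the dimension has to be
  a quantified number and cannot be the cardinality of an index type. We realise
  \<open>\<real>\<^sup>n\<close>, for all \<open>n\<close> at once, inside the space of finitely supported real sequences with the
  \<open>\<ell>\<^sup>2\<close> inner product: it is the subspace \<open>Rn n\<close> of the sequences that vanish from index \<open>n\<close> on.
  The notions of the library (topology, Borel sets, convex hull, diameter, derivative within a
  set, ...) then have their usual meaning on \<open>Rn n\<close>.
\<close>

typedef fseq = "{x :: nat \<Rightarrow> real. finite {i. x i \<noteq> 0}}"
  morphisms coord Abs_fseq
  by (rule exI[of _ "\<lambda>_. 0"]) simp

setup_lifting type_definition_fseq

lemma fseq_eqI: "(\<And>i. coord x i = coord y i) \<Longrightarrow> x = y"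
  by (simp add: coord_inject[symmetric] fun_eq_iff)

lemma finite_coord [simp]: "finite {i. coord x i \<noteq> 0}"
  using coord[of x] by simp

instantiation fseq :: real_vector
begin

lift_definition zero_fseq :: fseq is "\<lambda>_. 0" by simp

lift_definition plus_fseq :: "fseq \<Rightarrow> fseq \<Rightarrow> fseq" is "\<lambda>x y i. x i + y i"
  subgoal for x y by (rule finite_subset[of _ "{i. x i \<noteq> 0} \<union> {i. y i \<noteq> 0}"]) auto
  done

lift_definition uminus_fseq :: "fseq \<Rightarrow> fseq" is "\<lambda>x i. - x i" by simp

lift_definition minus_fseq :: "fseq \<Rightarrow> fseq \<Rightarrow> fseq" is "\<lambda>x y i. x i - y i"
  subgoal for x y by (rule finite_subset[of _ "{i. x i \<noteq> 0} \<union> {i. y i \<noteq> 0}"]) auto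
  done

lift_definition scaleR_fseq :: "real \<Rightarrow> fseq \<Rightarrow> fseq" is "\<lambda>r x i. r * x i"
  by (rule finite_subset) auto

instance
  by standard (transfer; simp add: algebra_simps fun_eq_iff)+

end

lemma coord_zero [simp]: "coord 0 i = 0"
  and coord_add [simp]: "coord (x + y) i = coord x i + coord y i"
  and coord_uminus [simp]: "coord (- x) i = - coord x i"
  and coord_diff [simp]: "coord (x - y) i = coord x i - coord y i"
  and coord_scaleR [simp]: "coord (r *\<^sub>R x) i = r * coord x i"
  by (transfer; simp)+

instantiation fseq :: real_inner
begin

definition inner_fseq :: "fseq \<Rightarrow> fseq \<Rightarrow> real"
  where "inner_fseq x y = (\<Sum>i | coord x i \<noteq> 0. coord x i * coord y i)"

definition norm_fseq :: "fseq \<Rightarrow> real"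
  where "norm_fseq x = sqrt (inner x x)"

definition sgn_fseq :: "fseq \<Rightarrow> fseq"
  where "sgn_fseq x = x /\<^sub>R norm x"

definition dist_fseq :: "fseq \<Rightarrow> fseq \<Rightarrow> real"
  where "dist_fseq x y = norm (x - y)"

definition uniformity_fseq :: "(fseq \<times> fseq) filter"
  where "uniformity_fseq = (INF e\<in>{0<..}. principal {(x, y). dist x y < e})"

definition open_fseq :: "fseq set \<Rightarrow> bool"
  where "open_fseq U \<longleftrightarrow> (\<forall>x\<in>U. \<forall>\<^sub>F (x', y) in uniformity. x' = x \<longrightarrow> y \<in> U)"

lemma inner_fseq_superset:
  assumes "finite A" "{i. coord x i \<noteq> 0} \<subseteq> A"
  shows "inner x y = (\<Sum>i\<in>A. coord x i * coord y i)"
  unfolding inner_fseq_def by (rule sum.mono_neutral_left) (use assms in auto)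

instance
proof
  fix x y z :: fseq and r :: real
  let ?A = "{i. coord x i \<noteq> 0} \<union> {i. coord y i \<noteq> 0}"
  have sup: "inner v w = (\<Sum>i\<in>?A. coord v i * coord w i)"
    if "\<And>i. coord v i \<noteq> 0 \<Longrightarrow> i \<in> ?A" for v w
    by (rule inner_fseq_superset) (use that in auto)
  have x: "inner x w = (\<Sum>i\<in>?A. coord x i * coord w i)"
    and y: "inner y w = (\<Sum>i\<in>?A. coord y i * coord w i)" for w
    by (rule sup; simp)+
  show "inner x y = inner y x"
    unfolding x y by (simp add: mult.commute)
  have "inner (x + y) z = (\<Sum>i\<in>?A. coord (x + y) i * coord z i)"
    by (rule sup) auto
  then show "inner (x + y) z = inner x z + inner y z"
    unfolding x y by (simp add: distrib_right sum.distrib)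
  have "inner (r *\<^sub>R x) y = (\<Sum>i\<in>?A. coord (r *\<^sub>R x) i * coord y i)"
    by (rule sup) auto
  then show "inner (r *\<^sub>R x) y = r * inner x y"
    unfolding x by (simp add: sum_distrib_left mult.assoc)
  show "0 \<le> inner x x"
    by (auto simp: inner_fseq_def intro!: sum_nonneg)
  show "inner x x = 0 \<longleftrightarrow> x = 0"
  proof
    assume "inner x x = 0"
    then have "\<forall>i\<in>{i. coord x i \<noteq> 0}. coord x i * coord x i = 0"
      unfolding inner_fseq_def by (subst (asm) sum_nonneg_eq_0_iff) auto
    then show "x = 0"
      by (intro fseq_eqI) auto
  qed (simp add: inner_fseq_def)
qed (simp_all add: norm_fseq_def sgn_fseq_def dist_fseq_def uniformity_fseq_def open_fseq_def)

end

definition Rn :: "nat \<Rightarrow> fseq set"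
  where "Rn n = {x. \<forall>i\<ge>n. coord x i = 0}"

lemma inner_Rn: "x \<in> Rn n \<Longrightarrow> inner x y = (\<Sum>i<n. coord x i * coord y i)"
  by (rule inner_fseq_superset) (auto simp: Rn_def not_less[symmetric])

text \<open>The element of \<open>Rn n\<close> with coordinates \<open>u 0, \<dots>, u (n - 1)\<close>.\<close>

lift_definition Rn_vec :: "nat \<Rightarrow> (nat \<Rightarrow> real) \<Rightarrow> fseq" is "\<lambda>n u i. if i < n then u i else 0"
  by (rule finite_subset[of _ "{..<n}" for n]) auto

lemma Rn_vec_in_Rn: "Rn_vec n u \<in> Rn n"
  unfolding Rn_def by transfer simp

definition measure_support :: "'a::topological_space measure \<Rightarrow> 'a set"
  where "measure_support M =
    {x \<in> space M. \<forall>U. open U \<and> x \<in> U \<longrightarrow> emeasure M (U \<inter> space M) > 0}"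

definition log_laplace :: "fseq measure \<Rightarrow> fseq \<Rightarrow> real"
  where "log_laplace M t = ln (\<integral>x. exp (inner t x) \<partial>M)"

definition legendre :: "nat \<Rightarrow> (fseq \<Rightarrow> real) \<Rightarrow> fseq \<Rightarrow> ereal"
  where "legendre n L x = (SUP t\<in>Rn n. ereal (inner t x - L t))"

text \<open>
  The function \<open>f\<close> is continuously differentiable on \<open>Rn n\<close> with gradient \<open>F\<close>. The derivative is
  taken within \<open>Rn n\<close>; as \<open>F x \<in> Rn n\<close>, this determines \<open>F\<close> on \<open>Rn n\<close>. Values of \<open>f\<close> outside
  \<open>Rn n\<close> play no role.
\<close>

definition C1_with_gradient :: "nat \<Rightarrow> (fseq \<Rightarrow> real) \<Rightarrow> (fseq \<Rightarrow> fseq) \<Rightarrow> bool"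
  where "C1_with_gradient n f F \<longleftrightarrow>
    (\<forall>x\<in>Rn n. F x \<in> Rn n \<and> (f has_derivative (\<lambda>h. inner (F x) h)) (at x within Rn n)) \<and>
    continuous_on (Rn n) F"

text \<open>
  The supremum and the expectation are real-valued, so this is meaningful for nonempty
  bounded \<open>V\<close>; in the theorem \<open>V\<close> is even compact.
\<close>

definition gaussian_mean_width :: "nat \<Rightarrow> fseq set \<Rightarrow> real"
  where "gaussian_mean_width n V =
    (\<integral>u. (SUP z\<in>V. inner z (Rn_vec n u)) \<partial>(\<Pi>\<^sub>M i\<in>{..<n}. density lborel std_normal_density))"

end

theory Submission
  imports Defs
begin

text \<open>
  Let \<open>W\<close> be the closed convex hull of \<open>V\<close> and \<open>\<phi>\<^sub>x(\<lambda>) = \<langle>\<lambda>, x\<rangle> - \<Lambda>(\<lambda>)\<close>. For \<open>x\<close> in the support let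
  \<open>\<lambda>\<close> maximise \<open>\<phi>\<^sub>x\<close> on \<open>W\<close> and let \<open>y = \<nabla>\<Lambda>(\<lambda>)\<close>, the mean of the measure tilted by \<open>\<lambda>\<close>. The first
  order condition says that \<open>\<lambda>\<close> maximises \<open>\<langle>\<cdot>, x - y\<rangle>\<close> on \<open>W\<close>, so that the mean value theorem gives
  \<open>f(x) - f(y) \<le> \<langle>\<lambda>, x - y\<rangle>\<close>; as \<open>\<Lambda>\<^sup>*(y) = \<langle>\<lambda>, y\<rangle> - \<Lambda>(\<lambda>)\<close>, we get \<open>f(x) \<le> sup (f - \<Lambda>\<^sup>*) + \<phi>\<^sub>x(\<lambda>)\<close>.

  The integral of \<open>exp (\<phi>\<^sub>x(w))\<close> in \<open>x\<close> is 1 for every fixed \<open>w\<close>. To pass to \<open>w\<close> depending on \<open>x\<close>, average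
  over a Gaussian of variance \<open>s\<^sup>2\<close> around \<open>\<lambda>\<close>: since \<open>\<phi>\<^sub>x\<close> is concave with Hessian at least minus the
  squared diameter, this costs \<open>s\<^sup>2 n / 2\<close>. All these Gaussian densities are dominated by their supremum
  over \<open>W\<close>, whose total mass is at most \<open>exp (g(W) / s)\<close> by the dual form of Talagrand's transport
  inequality. Finally \<open>g(W) = g(V)\<close>, and \<open>s = (g(V) / n)\<^sup>1\<^sup>/\<^sup>3\<close> gives \<open>\<kappa> = 3 / 2\<close>.
\<close>

section \<open>The transport inequality for the Gaussian measure\<close>

text \<open>Jensen's inequality, from the tangent of \<open>exp\<close> at the mean \<open>m\<close>
  of \<open>v\<close>. The right side is an extended integral, so the case where
  \<open>exp (v x)\<close> fails to be integrable is trivial.\<close>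

lemma (in prob_space) exp_integral_le:
  assumes v: "integrable M v"
  shows "ennreal (exp (\<integral>x. v x \<partial>M)) \<le> (\<integral>\<^sup>+x. ennreal (exp (v x)) \<partial>M)"
proof (cases "(\<integral>\<^sup>+x. ennreal (exp (v x)) \<partial>M) = \<infinity>")
  case False
  have [measurable]: "v \<in> borel_measurable M" using v by auto
  have int: "integrable M (\<lambda>x. exp (v x))"
    by (rule integrableI_nonneg) (use False in \<open>auto simp: less_top\<close>)
  define m where "m = (\<integral>x. v x \<partial>M)"
  have "(\<integral>x. exp m * (1 + (v x - m)) \<partial>M) \<le> (\<integral>x. exp (v x) \<partial>M)"
  proof (rule integral_mono[OF _ int])
    show "integrable M (\<lambda>x. exp m * (1 + (v x - m)))" using v by auto
    show "exp m * (1 + (v x - m)) \<le> exp (v x)" for x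
      using mult_left_mono[OF exp_ge_add_one_self[of "v x - m"], of "exp m"]
      by (simp add: exp_diff)
  qed
  also have "(\<integral>x. exp m * (1 + (v x - m)) \<partial>M) = exp m"
    using v by (simp add: m_def prob_space)
  finally show ?thesis
    using int by (simp add: nn_integral_eq_integral m_def)
qed simp

section \<open>Prekopa-Leindler on the line, against the Gaussian density\<close>

text \<open>Layer cake formula: \<open>f x\<close> is the length of \<open>{0<..<f x}\<close>, and
  Fubini exchanges the two integrations.\<close>

lemma nn_integral_eq_superlevel:
  fixes f :: "real \<Rightarrow> real"
  assumes [measurable]: "f \<in> borel_measurable borel" and nonneg: "\<And>x. 0 \<le> f x"
  shows "(\<integral>\<^sup>+x. ennreal (f x) \<partial>lborel) =
    (\<integral>\<^sup>+s. indicator {0<..} s * emeasure lborel {x. s < f x} \<partial>lborel)"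
proof -
  have "(\<integral>\<^sup>+x. ennreal (f x) \<partial>lborel) = (\<integral>\<^sup>+x. (\<integral>\<^sup>+s. indicator {0<..<f x} s \<partial>lborel) \<partial>lborel)"
    using nonneg by simp
  also have "\<dots> = (\<integral>\<^sup>+x. (\<integral>\<^sup>+s. indicator {0<..} s * indicator {x. s < f x} x \<partial>lborel) \<partial>lborel)"
    by (intro nn_integral_cong) (auto split: split_indicator)
  also have "\<dots> = (\<integral>\<^sup>+s. (\<integral>\<^sup>+x. indicator {0<..} s * indicator {x. s < f x} x \<partial>lborel) \<partial>lborel)"
    by (rule lborel_pair.Fubini') simp
  also have "\<dots> = (\<integral>\<^sup>+s. indicator {0<..} s * emeasure lborel {x. s < f x} \<partial>lborel)"
    by (intro nn_integral_cong) (simp add: nn_integral_cmult)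
  finally show ?thesis .
qed

text \<open>\<open>A\<close> and \<open>B\<close> lie between their infima and suprema, and the
  bound on \<open>a * x + b * y\<close> passes to both. This is the one-dimensional Brunn-Minkowski
  inequality inside a symmetric interval of length \<open>2 * r\<close>.\<close>

lemma emeasure_convex_combination_le:
  fixes A B :: "real set"
  assumes ab: "0 < a" "0 < b" and AB: "A \<noteq> {}" "B \<noteq> {}"
    and sub: "\<And>x y. x \<in> A \<Longrightarrow> y \<in> B \<Longrightarrow> \<bar>a * x + b * y\<bar> \<le> r"
  shows "ennreal a * emeasure lborel A + ennreal b * emeasure lborel B \<le> ennreal (2 * r)"
proof -
  obtain x0 y0 where x0: "x0 \<in> A" and y0: "y0 \<in> B" using AB by auto
  have sub': "a * x + b * y \<le> r" "- r \<le> a * x + b * y" if "x \<in> A" "y \<in> B" for x y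
    using sub[OF that] by linarith+
  have bA: "x \<le> (r - b * y0) / a" "(- r - b * y0) / a \<le> x" if "x \<in> A" for x
    using sub'[OF that y0] ab by (simp_all add: field_simps)
  have bB: "y \<le> (r - a * x0) / b" "(- r - a * x0) / b \<le> y" if "y \<in> B" for y
    using sub'[OF x0 that] ab by (simp_all add: field_simps)
  have bdA: "bdd_above A" "bdd_below A" by (rule bdd_aboveI, erule bA(1)) (rule bdd_belowI, erule bA(2))
  have bdB: "bdd_above B" "bdd_below B" by (rule bdd_aboveI, erule bB(1)) (rule bdd_belowI, erule bB(2))
  have up: "a * Sup A + b * Sup B \<le> r"
  proof -
    have 1: "x \<le> (r - b * Sup B) / a" if "x \<in> A" for x
    proof -
      have "Sup B \<le> (r - a * x) / b"
        using sub'[OF that] ab by (intro cSup_least AB) (simp add: field_simps)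
      then show ?thesis using ab by (simp add: field_simps)
    qed
    have "Sup A \<le> (r - b * Sup B) / a"
      using 1 by (intro cSup_least AB) auto
    then show ?thesis using ab by (simp add: field_simps)
  qed
  have low: "- r \<le> a * Inf A + b * Inf B"
  proof -
    have 1: "(- r - b * Inf B) / a \<le> x" if "x \<in> A" for x
    proof -
      have "(- r - a * x) / b \<le> Inf B"
        using sub'[OF that] ab by (intro cInf_greatest AB) (simp add: field_simps)
      then show ?thesis using ab by (simp add: field_simps)
    qed
    have "(- r - b * Inf B) / a \<le> Inf A"
      using 1 by (intro cInf_greatest AB) auto
    then show ?thesis using ab by (simp add: field_simps)
  qed
  have iA: "Inf A \<le> Sup A" and iB: "Inf B \<le> Sup B"
    using bdA bdB AB by (auto intro: cInf_le_cSup)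
  have "emeasure lborel A \<le> emeasure lborel {Inf A..Sup A}"
    by (rule emeasure_mono) (use bdA in \<open>auto intro: cInf_lower cSup_upper\<close>)
  moreover have "emeasure lborel B \<le> emeasure lborel {Inf B..Sup B}"
    by (rule emeasure_mono) (use bdB in \<open>auto intro: cInf_lower cSup_upper\<close>)
  ultimately have "ennreal a * emeasure lborel A + ennreal b * emeasure lborel B
      \<le> ennreal a * ennreal (Sup A - Inf A) + ennreal b * ennreal (Sup B - Inf B)"
    using iA iB by (intro add_mono mult_left_mono) auto
  also have "\<dots> = ennreal (a * (Sup A - Inf A) + b * (Sup B - Inf B))"
    using ab iA iB by (simp add: ennreal_mult[symmetric] ennreal_plus[symmetric] del: ennreal_plus)
  also have "\<dots> \<le> ennreal (2 * r)"
    using up low by (intro ennreal_leI) (simp add: algebra_simps)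
  finally show ?thesis .
qed

lemma superlevel_std_normal_density:
  assumes "0 < s"
  shows "\<exists>r. {z. s < std_normal_density z} = {-r<..<r} \<and> ({z. s < std_normal_density z} \<noteq> {} \<longrightarrow> 0 \<le> r)"
proof -
  \<comment> \<open>Found by solving \<open>s = std_normal_density z\<close> for
    \<open>z\<^sup>2\<close>; it is positive exactly when \<open>s\<close> lies below the maximum of
    the density.\<close>
  define q where "q = - 2 * ln (s * sqrt (2 * pi))"
  have pos: "s * sqrt (2 * pi) > 0" using assms by simp
  have *: "s < std_normal_density z \<longleftrightarrow> z\<^sup>2 < q" for z
  proof -
    have "s < std_normal_density z \<longleftrightarrow> s * sqrt (2 * pi) < exp (- z\<^sup>2 / 2)"
      using pos_less_divide_eq[of "sqrt (2 * pi)" s "exp (- z\<^sup>2 / 2)"]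
      by (simp add: std_normal_density_def del: real_sqrt_mult)
    also have "\<dots> \<longleftrightarrow> ln (s * sqrt (2 * pi)) < - z\<^sup>2 / 2"
      using ln_less_cancel_iff[OF pos exp_gt_zero, of "- z\<^sup>2 / 2"] by (simp only: ln_exp)
    finally show ?thesis by (auto simp: q_def)
  qed
  show ?thesis
  proof (cases "q > 0")
    case True
    have "s < std_normal_density z \<longleftrightarrow> z \<in> {- sqrt q<..<sqrt q}" for z
      unfolding * using real_sqrt_less_iff[of "z\<^sup>2" q] by (auto simp only: real_sqrt_abs abs_less_iff greaterThanLessThan_iff)
    then have "{z. s < std_normal_density z} = {- sqrt q<..<sqrt q}" by blast
    then show ?thesis using True by (intro exI[of _ "sqrt q"]) auto
  next
    case False
    then have "\<not> s < std_normal_density z" for z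
      unfolding * using zero_le_power2[of z] by linarith
    then show ?thesis by (intro exI[of _ 0]) auto
  qed
qed

text \<open>
  Since the superlevel sets of the Gaussian density are intervals, the Brunn-Minkowski inequality on the
  line reduces to comparing lengths of intervals.
\<close>

lemma prekopa_leindler_std_normal:
  fixes a b :: "real \<Rightarrow> real"
  assumes t: "0 < t" "t < 1"
    and [measurable]: "a \<in> borel_measurable borel" "b \<in> borel_measurable borel"
    and nonneg: "\<And>x. 0 \<le> a x" "\<And>x. 0 \<le> b x" and pos: "0 < a x0" "0 < b y0"
    and le: "\<And>x y. a x powr t * b y powr (1 - t) \<le> std_normal_density (t * x + (1 - t) * y)"
  obtains Ia Ib where "0 \<le> Ia" "0 \<le> Ib"
    "(\<integral>\<^sup>+x. ennreal (a x) \<partial>lborel) = ennreal Ia" "(\<integral>\<^sup>+x. ennreal (b x) \<partial>lborel) = ennreal Ib"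
    "Ia powr t * Ib powr (1 - t) \<le> 1"
proof -
  \<comment> \<open>The maximum of the density. Fixing \<open>y0\<close>, where \<open>b\<close> is
    positive, bounds \<open>a\<close>, and fixing \<open>x0\<close> bounds \<open>b\<close>, so that
    both suprema are finite.\<close>
  define m :: real where "m = 1 / sqrt (2 * pi)"
  have m: "std_normal_density z \<le> m" for z
    by (simp add: std_normal_density_def m_def divide_right_mono)
  have le_m: "a x powr t * b y powr (1 - t) \<le> m" for x y
    using le[of x y] m[of "t * x + (1 - t) * y"] by linarith
  have powr_inv: "z \<le> k powr (1 / q)" if "z powr q \<le> k" "0 \<le> z" "0 < q" for z k q :: real
  proof -
    have "z = (z powr q) powr (1 / q)" using that by (simp add: powr_powr)
    also have "\<dots> \<le> k powr (1 / q)" using that by (intro powr_mono2) auto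
    finally show ?thesis .
  qed
  have "a x \<le> (m / b y0 powr (1 - t)) powr (1 / t)" for x
    using le_m[of x y0] pos t nonneg by (intro powr_inv) (auto simp: field_simps)
  then have bda: "bdd_above (range a)" by (auto intro!: bdd_aboveI2)
  have "b y \<le> (m / a x0 powr t) powr (1 / (1 - t))" for y
    using le_m[of x0 y] pos t nonneg by (intro powr_inv) (auto simp: field_simps)
  then have bdb: "bdd_above (range b)" by (auto intro!: bdd_aboveI2)
  define \<alpha> \<beta> where "\<alpha> = (SUP x. a x)" and "\<beta> = (SUP x. b x)"
  have le_sup: "a x \<le> \<alpha>" "b x \<le> \<beta>" for x
    unfolding \<alpha>_def \<beta>_def using bda bdb by (auto intro: cSUP_upper)
  have sup_pos: "0 < \<alpha>" "0 < \<beta>"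
    using le_sup(1)[of x0] le_sup(2)[of y0] pos by linarith+
  define c where "c = 1 / (\<alpha> powr t * \<beta> powr (1 - t))"
  have c: "0 < c" using sup_pos by (simp add: c_def)
  \<comment> \<open>Both functions are scaled to supremum 1: then for every level
    \<open>s < 1\<close> both superlevel sets are nonempty, as Brunn-Minkowski requires. The scaling
    costs the factor \<open>c\<close> in front of the density.\<close>
  define A B where "A x = a x / \<alpha>" and "B x = b x / \<beta>" for x
  have [measurable]: "A \<in> borel_measurable borel" "B \<in> borel_measurable borel"
    unfolding A_def[abs_def] B_def[abs_def] by measurable
  have AB0: "0 \<le> A x" "0 \<le> B x" for x using sup_pos nonneg by (auto simp: A_def B_def)
  have AB1: "A x \<le> 1" "B x \<le> 1" for x using sup_pos le_sup by (auto simp: A_def B_def)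
  have level: "ennreal t * emeasure lborel {x. s < A x} + ennreal (1 - t) * emeasure lborel {x. s < B x}
      \<le> emeasure lborel {x. s < c * std_normal_density x}" if s: "0 < s" for s
  proof (cases "s < 1")
    case False
    then have "{x. s < A x} = {}" "{x. s < B x} = {}"
      using AB1 by (force simp: not_less intro: order_trans)+
    then show ?thesis by simp
  next
    case True
    have "s * \<alpha> < \<alpha>" "s * \<beta> < \<beta>" using True sup_pos by auto
    then have "\<exists>x. s * \<alpha> < a x" "\<exists>x. s * \<beta> < b x"
      using less_cSUP_iff[OF _ bda, of "s * \<alpha>"] less_cSUP_iff[OF _ bdb, of "s * \<beta>"]
      by (auto simp: \<alpha>_def \<beta>_def)
    then have ne: "{x. s < A x} \<noteq> {}" "{x. s < B x} \<noteq> {}"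
      using sup_pos by (auto simp: A_def B_def field_simps)
    obtain r where r: "{z. s / c < std_normal_density z} = {-r<..<r}"
      "{z. s / c < std_normal_density z} \<noteq> {} \<Longrightarrow> 0 \<le> r"
      using superlevel_std_normal_density[of "s / c"] s c by auto
    have in_r: "t * x + (1 - t) * y \<in> {-r<..<r}" if "s < A x" "s < B y" for x y
    proof -
      have "s = s powr t * s powr (1 - t)" using s by (simp flip: powr_add)
      also have "\<dots> < A x powr t * B y powr (1 - t)"
        using s that t by (intro mult_strict_mono powr_less_mono2) auto
      also have "\<dots> = c * (a x powr t * b y powr (1 - t))"
        using nonneg sup_pos by (simp add: A_def B_def c_def powr_divide)
      also have "\<dots> \<le> c * std_normal_density (t * x + (1 - t) * y)"
        using le c by (intro mult_left_mono) auto
      finally have "s / c < std_normal_density (t * x + (1 - t) * y)"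
        using c by (simp add: pos_divide_less_eq mult.commute)
      then show ?thesis unfolding r(1)[symmetric] by simp
    qed
    have "{z. s / c < std_normal_density z} \<noteq> {}" using in_r ne r(1) by blast
    then have r0: "0 \<le> r" by (rule r(2))
    have "ennreal t * emeasure lborel {x. s < A x} + ennreal (1 - t) * emeasure lborel {x. s < B x}
        \<le> ennreal (2 * r)"
    proof (rule emeasure_convex_combination_le)
      fix x y assume "x \<in> {x. s < A x}" "y \<in> {x. s < B x}"
      then show "\<bar>t * x + (1 - t) * y\<bar> \<le> r" using in_r[of x y] by auto
    qed (use t ne in auto)
    also have "\<dots> = emeasure lborel {-r<..<r}" using r0 by simp
    also have "{-r<..<r} = {x. s < c * std_normal_density x}"
      unfolding r(1)[symmetric] using c by (simp add: pos_divide_less_eq mult.commute)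
    finally show ?thesis .
  qed
  \<comment> \<open>The level inequality is integrated over all \<open>s\<close>, and the layer cake
    formula turns it into one between integrals.\<close>
  have "ennreal t * (\<integral>\<^sup>+x. ennreal (A x) \<partial>lborel) + ennreal (1 - t) * (\<integral>\<^sup>+x. ennreal (B x) \<partial>lborel)
      = (\<integral>\<^sup>+s. ennreal t * (indicator {0<..} s * emeasure lborel {x. s < A x})
         + ennreal (1 - t) * (indicator {0<..} s * emeasure lborel {x. s < B x}) \<partial>lborel)"
    by (simp add: nn_integral_eq_superlevel AB0 nn_integral_add nn_integral_cmult)
  also have "\<dots> \<le> (\<integral>\<^sup>+s. indicator {0<..} s * emeasure lborel {x. s < c * std_normal_density x} \<partial>lborel)"
    by (intro nn_integral_mono) (use level in \<open>auto split: split_indicator\<close>)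
  also have "\<dots> = (\<integral>\<^sup>+x. ennreal (c * std_normal_density x) \<partial>lborel)"
    using c by (intro nn_integral_eq_superlevel[symmetric]) auto
  also have "\<dots> = ennreal c * (\<integral>\<^sup>+x. ennreal (std_normal_density x) \<partial>lborel)"
    using c by (simp add: ennreal_mult nn_integral_cmult)
  also have "(\<integral>\<^sup>+x. ennreal (std_normal_density x) \<partial>lborel) = 1"
    using prob_space.emeasure_space_1[OF prob_space_normal_density[of 1 0]]
    by (simp add: emeasure_density)
  finally have sum_le: "ennreal t * (\<integral>\<^sup>+x. ennreal (A x) \<partial>lborel) +
      ennreal (1 - t) * (\<integral>\<^sup>+x. ennreal (B x) \<partial>lborel) \<le> ennreal c" by simp
  have fin: "(\<integral>\<^sup>+x. ennreal (A x) \<partial>lborel) \<noteq> \<infinity>" "(\<integral>\<^sup>+x. ennreal (B x) \<partial>lborel) \<noteq> \<infinity>"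
    using sum_le t by (auto simp: ennreal_mult_eq_top_iff top_unique ennreal_mult_top)
  then obtain IA IB where I0: "0 \<le> IA" "0 \<le> IB"
    and I: "(\<integral>\<^sup>+x. ennreal (A x) \<partial>lborel) = ennreal IA" "(\<integral>\<^sup>+x. ennreal (B x) \<partial>lborel) = ennreal IB"
    by (metis ennreal_cases infinity_ennreal_def)
  have "t * IA + (1 - t) * IB \<le> c"
    using sum_le t I0 c unfolding I
    by (simp add: ennreal_mult[symmetric] ennreal_plus[symmetric] del: ennreal_plus)
  \<comment> \<open>The weighted arithmetic-geometric mean inequality leads to products, where
    \<open>c\<close> cancels the scaling by \<open>\<alpha>\<close> and
    \<open>\<beta>\<close>.\<close>
  moreover have "IA powr t * IB powr (1 - t) \<le> t * IA + (1 - t) * IB"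
  proof (cases "IA = 0 \<or> IB = 0")
    case False
    then show ?thesis using Youngs_inequality_0[of t "1 - t" IA IB] t I0 by auto
  qed (use t I0 in auto)
  ultimately have "IA powr t * IB powr (1 - t) \<le> c" by linarith
  then have fin_le: "(\<alpha> * IA) powr t * (\<beta> * IB) powr (1 - t) \<le> 1"
    using sup_pos I0 by (simp add: powr_mult c_def field_simps)
  have "(\<integral>\<^sup>+x. ennreal (a x) \<partial>lborel) = (\<integral>\<^sup>+x. ennreal \<alpha> * ennreal (A x) \<partial>lborel)"
    using sup_pos AB0 by (intro nn_integral_cong) (simp flip: ennreal_mult add: A_def)
  then have Ia: "(\<integral>\<^sup>+x. ennreal (a x) \<partial>lborel) = ennreal (\<alpha> * IA)"
    using sup_pos I0 by (simp add: nn_integral_cmult I ennreal_mult)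
  have "(\<integral>\<^sup>+x. ennreal (b x) \<partial>lborel) = (\<integral>\<^sup>+x. ennreal \<beta> * ennreal (B x) \<partial>lborel)"
    using sup_pos AB0 by (intro nn_integral_cong) (simp flip: ennreal_mult add: B_def)
  then have Ib: "(\<integral>\<^sup>+x. ennreal (b x) \<partial>lborel) = ennreal (\<beta> * IB)"
    using sup_pos I0 by (simp add: nn_integral_cmult I ennreal_mult)
  show ?thesis
    by (rule that[OF _ _ Ia Ib fin_le]) (use sup_pos I0 in auto)
qed

section \<open>The one-dimensional Gaussian measure and its transport inequality\<close>

definition std_gauss :: "real measure" where "std_gauss = density lborel std_normal_density"

lemma sets_std_gauss [simp, measurable_cong]: "sets std_gauss = sets borel"
  by (simp add: std_gauss_def)

lemma space_std_gauss [simp]: "space std_gauss = UNIV"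
  by (simp add: std_gauss_def)

interpretation std_gauss: prob_space std_gauss
  unfolding std_gauss_def by (rule prob_space_normal_density) simp

lemma integrable_std_gauss_abs: "integrable std_gauss (\<lambda>x. \<bar>x\<bar>)"
  using integrable_std_normal_moment_abs[of 1]
  by (simp add: std_gauss_def integrable_density)

text \<open>Completing the square: tilting by \<open>exp (c * x)\<close> moves the centre of the
  density to \<open>c\<close> and leaves a constant factor.\<close>

lemma nn_integral_exp_std_gauss:
  "(\<integral>\<^sup>+x. ennreal (exp (c * x)) \<partial>std_gauss) = ennreal (exp (c\<^sup>2 / 2))"
proof -
  have "(\<integral>\<^sup>+x. ennreal (exp (c * x)) \<partial>std_gauss)
      = (\<integral>\<^sup>+x. ennreal (exp (c\<^sup>2 / 2)) * ennreal (normal_density c 1 x) \<partial>lborel)"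
    unfolding std_gauss_def
    by (subst nn_integral_density, simp, simp, intro nn_integral_cong)
      (simp add: normal_density_def power2_eq_square field_simps flip: ennreal_mult exp_add)
  also have "\<dots> = ennreal (exp (c\<^sup>2 / 2)) * (\<integral>\<^sup>+x. ennreal (normal_density c 1 x) \<partial>lborel)"
    by (simp add: nn_integral_cmult)
  also have "(\<integral>\<^sup>+x. ennreal (normal_density c 1 x) \<partial>lborel) = 1"
    using prob_space.emeasure_space_1[OF prob_space_normal_density[of 1 c]]
    by (simp add: emeasure_density)
  finally show ?thesis by simp
qed

text \<open>
  Talagrand's inequality in dual form. Prekopa-Leindler with weights \<open>t\<close> and \<open>1 - t\<close> loses the factor
  \<open>1 - t\<close> in the cost, so the sharp constant, which is essential later, appears for \<open>t \<rightarrow> 0\<close>.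
\<close>

lemma std_gauss_transport:
  fixes h :: "real \<Rightarrow> real" and p :: "real \<Rightarrow> ennreal"
  assumes t: "0 < t" "t < 1"
    and p[measurable]: "p \<in> borel_measurable borel" and h: "integrable std_gauss h"
    and le: "\<And>x y. p x \<le> ennreal (exp (h y + (1 - t) / 2 * (x - y)\<^sup>2))"
  shows "(\<integral>\<^sup>+x. p x \<partial>std_gauss) \<le> ennreal (exp (\<integral>x. h x \<partial>std_gauss))"
proof (cases "\<exists>x0. p x0 > 0")
  case False
  then have "p = (\<lambda>_. 0)" by (auto simp: not_less)
  then show ?thesis by simp
next
  case True
  then obtain x0 where x0: "p x0 > 0" by blast
  have [measurable]: "h \<in> borel_measurable borel"
    using borel_measurable_integrable[OF h] by (simp cong: measurable_cong_sets)
  have p_fin: "p x < \<infinity>" for x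
    using le[of x 0] by (auto simp: less_top[symmetric] top_unique)
  define q where "q x = enn2real (p x)" for x
  have pq: "p x = ennreal (q x)" for x using p_fin[of x] by (simp add: q_def)
  have q0: "0 \<le> q x" for x by (simp add: q_def)
  have [measurable]: "q \<in> borel_measurable borel" unfolding q_def[abs_def] by measurable
  have q_le: "q x \<le> exp (h y + (1 - t) / 2 * (x - y)\<^sup>2)" for x y
    using le[of x y] q0[of x] by (simp add: pq)
  \<comment> \<open>Chosen so that the power \<open>1 - t\<close> of \<open>b\<close> carries
    \<open>exp (- t * h y)\<close>, which cancels the \<open>h\<close>-part of the power
    \<open>t\<close> of \<open>a\<close>.\<close>
  define \<theta> where "\<theta> = t / (1 - t)"
  define a b where "a x = q x * std_normal_density x"
    and "b x = exp (- \<theta> * h x) * std_normal_density x" for x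
  have le': "a x powr t * b y powr (1 - t) \<le> std_normal_density (t * x + (1 - t) * y)" for x y
  proof -
    let ?k = "1 / sqrt (2 * pi)"
    have k: "?k > 0" by simp
    have dens: "std_normal_density z powr u = ?k powr u * exp (- u * z\<^sup>2 / 2)" for z u
      unfolding std_normal_density_def using k by (subst powr_mult) (auto simp: exp_powr_real)
    have "a x powr t \<le> exp (t * (h y + (1 - t) / 2 * (x - y)\<^sup>2)) * (?k powr t * exp (- t * x\<^sup>2 / 2))"
    proof -
      have "a x powr t = q x powr t * std_normal_density x powr t"
        using q0[of x] by (simp add: a_def powr_mult)
      also have "\<dots> \<le> exp (h y + (1 - t) / 2 * (x - y)\<^sup>2) powr t * std_normal_density x powr t"
        using q_le[of x y] q0[of x] t by (intro mult_right_mono powr_mono2) auto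
      also have "\<dots> = exp (t * (h y + (1 - t) / 2 * (x - y)\<^sup>2)) * (?k powr t * exp (- t * x\<^sup>2 / 2))"
        by (simp only: dens exp_powr_real mult.commute[of _ t])
      finally show ?thesis .
    qed
    moreover have "b y powr (1 - t) = exp (- t * h y) * (?k powr (1 - t) * exp (- (1 - t) * y\<^sup>2 / 2))"
    proof -
      have "b y powr (1 - t) = exp (- \<theta> * h y) powr (1 - t) * std_normal_density y powr (1 - t)"
        by (simp add: b_def powr_mult)
      also have "exp (- \<theta> * h y) powr (1 - t) = exp (- t * h y)"
        unfolding exp_powr_real using t by (simp add: \<theta>_def)
      finally show ?thesis by (simp only: dens)
    qed
    ultimately have "a x powr t * b y powr (1 - t)
        \<le> exp (t * (h y + (1 - t) / 2 * (x - y)\<^sup>2)) * (?k powr t * exp (- t * x\<^sup>2 / 2)) *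
          (exp (- t * h y) * (?k powr (1 - t) * exp (- (1 - t) * y\<^sup>2 / 2)))"
      by (simp only: mult_right_mono exp_ge_zero powr_ge_zero mult_nonneg_nonneg)
    also have "\<dots> = (?k powr t * ?k powr (1 - t)) *
        (exp (t * (h y + (1 - t) / 2 * (x - y)\<^sup>2)) * exp (- t * x\<^sup>2 / 2) *
         exp (- t * h y) * exp (- (1 - t) * y\<^sup>2 / 2))"
      by (simp only: mult_ac)
    also have "\<dots> = ?k * exp (t * (h y + (1 - t) / 2 * (x - y)\<^sup>2) + - t * x\<^sup>2 / 2 +
         - t * h y + - (1 - t) * y\<^sup>2 / 2)"
      using k by (simp only: powr_add[symmetric] exp_add[symmetric]) simp
    \<comment> \<open>The weight \<open>(1 - t) / 2\<close> of the cost is the one for which the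
      exponents combine to a single square.\<close>
    also have "t * (h y + (1 - t) / 2 * (x - y)\<^sup>2) + - t * x\<^sup>2 / 2 + - t * h y + - (1 - t) * y\<^sup>2 / 2
        = - (t * x + (1 - t) * y)\<^sup>2 / 2"
      by (simp add: power2_eq_square field_simps)
    finally show ?thesis by (simp add: std_normal_density_def)
  qed
  have "0 < q x0" using x0 by (simp add: pq)
  then have ab0: "0 < a x0" "0 < b 0" "\<And>x. 0 \<le> a x" "\<And>x. 0 \<le> b x"
    using q0 by (simp_all add: a_def b_def normal_density_pos)
  have [measurable]: "a \<in> borel_measurable borel" "b \<in> borel_measurable borel"
    unfolding a_def[abs_def] b_def[abs_def] by measurable
  obtain Ia Ib where I: "0 \<le> Ia" "0 \<le> Ib"
    "(\<integral>\<^sup>+x. ennreal (a x) \<partial>lborel) = ennreal Ia" "(\<integral>\<^sup>+x. ennreal (b x) \<partial>lborel) = ennreal Ib"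
    "Ia powr t * Ib powr (1 - t) \<le> 1"
    using prekopa_leindler_std_normal[OF t _ _ ab0(3,4,1,2) le'] by auto
  have Ia: "(\<integral>\<^sup>+x. p x \<partial>std_gauss) = ennreal Ia"
    unfolding I(3)[symmetric] std_gauss_def
    by (simp add: nn_integral_density pq a_def ennreal_mult q0 mult.commute)
  have Ib: "(\<integral>\<^sup>+x. ennreal (exp (- \<theta> * h x)) \<partial>std_gauss) = ennreal Ib"
    unfolding I(4)[symmetric] std_gauss_def
    by (simp add: nn_integral_density b_def ennreal_mult mult.commute)
  define H where "H = (\<integral>x. h x \<partial>std_gauss)"
  \<comment> \<open>Jensen bounds \<open>Ib\<close> from below; by Prekopa-Leindler this bounds
    \<open>Ia\<close> from above.\<close>
  have "ennreal (exp (\<integral>x. - \<theta> * h x \<partial>std_gauss)) \<le> ennreal Ib"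
    unfolding Ib[symmetric] by (rule std_gauss.exp_integral_le) (use h in auto)
  then have "exp (- \<theta> * H) \<le> Ib" using I(2) by (simp add: H_def)
  then have "exp (- \<theta> * H) powr (1 - t) \<le> Ib powr (1 - t)"
    using t by (intro powr_mono2) auto
  moreover have "exp (- \<theta> * H) powr (1 - t) = exp (- t * H)"
    unfolding exp_powr_real using t by (simp add: \<theta>_def)
  ultimately have "Ia powr t * exp (- t * H) \<le> Ia powr t * Ib powr (1 - t)"
    by (intro mult_left_mono) auto
  then have "Ia powr t * exp (- t * H) \<le> 1" using I(5) by linarith
  then have "Ia powr t \<le> exp H powr t"
    by (simp add: exp_powr_real exp_minus field_simps)
  then have "Ia \<le> exp H"
    using t I(1) powr_less_mono2[of t "exp H" Ia] by (force simp: not_less[symmetric])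
  then show ?thesis unfolding Ia H_def[symmetric] by (rule ennreal_leI)
qed

section \<open>Tensorisation to finite products\<close>

interpretation gauss: product_prob_space "\<lambda>_::nat. std_gauss" UNIV
  by unfold_locales

lemma space_PiM_std_gauss: "space (\<Pi>\<^sub>M i\<in>I. std_gauss) = PiE I (\<lambda>_. UNIV)"
  by (simp add: space_PiM)

lemma integrable_PiM_std_gauss_abs:
  assumes "finite I" "i \<in> I"
  shows "integrable (\<Pi>\<^sub>M (i::nat)\<in>I. std_gauss) (\<lambda>x. \<bar>x i\<bar>)"
proof -
  have "distr (\<Pi>\<^sub>M (i::nat)\<in>I. std_gauss) std_gauss (\<lambda>x. x i) = std_gauss"
    by (rule distr_PiM_component[OF std_gauss.prob_space_axioms]) (use assms in auto)
  then have "integrable (distr (\<Pi>\<^sub>M (i::nat)\<in>I. std_gauss) std_gauss (\<lambda>x. x i)) (\<lambda>x. \<bar>x\<bar>)"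
    using integrable_std_gauss_abs by simp
  then show ?thesis
    by (subst (asm) integrable_distr_eq) (use assms in auto)
qed

lemma integrable_PiM_std_gauss:
  fixes h :: "(nat \<Rightarrow> real) \<Rightarrow> real"
  assumes "finite I" and h: "h \<in> borel_measurable (\<Pi>\<^sub>M i\<in>I. std_gauss)"
    and growth: "\<And>y. y \<in> PiE I (\<lambda>_. UNIV) \<Longrightarrow> \<bar>h y\<bar> \<le> C + D * (\<Sum>i\<in>I. \<bar>y i\<bar>)"
  shows "integrable (\<Pi>\<^sub>M i\<in>I. std_gauss) h"
proof (rule Bochner_Integration.integrable_bound[OF _ h])
  interpret P: prob_space "\<Pi>\<^sub>M (i::nat)\<in>I. std_gauss"
    by (rule prob_space_PiM) (rule std_gauss.prob_space_axioms)
  show "integrable (\<Pi>\<^sub>M i\<in>I. std_gauss) (\<lambda>y. C + D * (\<Sum>i\<in>I. \<bar>y i\<bar>))"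
    using integrable_PiM_std_gauss_abs[OF assms(1)] by auto
  show "AE y in \<Pi>\<^sub>M i\<in>I. std_gauss. norm (h y) \<le> norm (C + D * (\<Sum>i\<in>I. \<bar>y i\<bar>))"
    using growth by (intro AE_I2) (fastforce simp: space_PiM_std_gauss)
qed

text \<open>Induction on the coordinates: one coordinate is integrated out by the one-dimensional
  inequality, and the partial integrals inherit the hypotheses because the squared distance is a sum
  over coordinates. The growth bound gives integrability; its constant \<open>C\<close> varies in
  the induction, as it absorbs the first absolute moment of the new coordinate.\<close>

lemma std_gauss_transport_PiM:
  fixes h :: "(nat \<Rightarrow> real) \<Rightarrow> real" and p :: "(nat \<Rightarrow> real) \<Rightarrow> ennreal"
  assumes "finite I" and t: "0 < t" "t < 1"
    and "p \<in> borel_measurable (\<Pi>\<^sub>M i\<in>I. std_gauss)" "h \<in> borel_measurable (\<Pi>\<^sub>M i\<in>I. std_gauss)"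
    and "\<And>y. y \<in> PiE I (\<lambda>_. UNIV) \<Longrightarrow> \<bar>h y\<bar> \<le> C + D * (\<Sum>i\<in>I. \<bar>y i\<bar>)"
    and "\<And>x y. x \<in> PiE I (\<lambda>_. UNIV) \<Longrightarrow> y \<in> PiE I (\<lambda>_. UNIV) \<Longrightarrow>
      p x \<le> ennreal (exp (h y + (1 - t) / 2 * (\<Sum>i\<in>I. (x i - y i)\<^sup>2)))"
  shows "(\<integral>\<^sup>+x. p x \<partial>(\<Pi>\<^sub>M i\<in>I. std_gauss)) \<le> ennreal (exp (\<integral>x. h x \<partial>(\<Pi>\<^sub>M i\<in>I. std_gauss)))"
  using assms(1,4-)
proof (induction I arbitrary: p h C rule: finite_induct)
  case empty
  show ?case
    using empty(4)[of "\<lambda>_. undefined" "\<lambda>_. undefined"]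
    by (simp add: PiM_empty nn_integral_count_space_finite lebesgue_integral_count_space_finite)
next
  case (insert j I)
  note [measurable] = insert.prems(1,2)
  note fin = \<open>finite I\<close> and j = \<open>j \<notin> I\<close>
  let ?P = "\<Pi>\<^sub>M i\<in>I. std_gauss" and ?X = "PiE I (\<lambda>_. UNIV) :: (nat \<Rightarrow> real) set"
  have upd: "x(j := a) \<in> PiE (insert j I) (\<lambda>_. UNIV)" if "x \<in> ?X" for x and a :: real
    using that by (auto simp: PiE_def extensional_def)
  have upd_sum: "(\<Sum>i\<in>insert j I. g i ((x(j := a)) i) ((y(j := b)) i)) = g j a b + (\<Sum>i\<in>I. g i (x i) (y i))"
    for x y :: "nat \<Rightarrow> real" and a b and g :: "nat \<Rightarrow> real \<Rightarrow> real \<Rightarrow> real"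
    using fin j by (subst sum.insert) (auto intro!: arg_cong2[of _ _ _ _ "(+)"] sum.cong)
  have slice: "(\<lambda>a. x(j := a)) \<in> std_gauss \<rightarrow>\<^sub>M (\<Pi>\<^sub>M i\<in>insert j I. std_gauss)" if "x \<in> ?X" for x
    using measurable_component_update[of x I "\<lambda>_. std_gauss" j] that j by (simp add: space_PiM_std_gauss)
  have D: "\<bar>h (x(j := b))\<bar> \<le> C + D * \<bar>b\<bar> + D * (\<Sum>i\<in>I. \<bar>x i\<bar>)" if "x \<in> ?X" for x b
    using insert.prems(3)[OF upd[OF that, of b]] upd_sum[of "\<lambda>_ u _. \<bar>u\<bar>" x b x b]
    by (simp add: algebra_simps fun_upd_def)
  have int_slice: "integrable std_gauss (\<lambda>b. h (x(j := b)))" if x: "x \<in> ?X" for x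
  proof (rule Bochner_Integration.integrable_bound)
    show "integrable std_gauss (\<lambda>b. C + D * \<bar>b\<bar> + D * (\<Sum>i\<in>I. \<bar>x i\<bar>))"
      using integrable_std_gauss_abs by simp
    show "(\<lambda>b. h (x(j := b))) \<in> borel_measurable std_gauss"
      using slice[OF x] by measurable
    show "AE b in std_gauss. norm (h (x(j := b))) \<le> norm (C + D * \<bar>b\<bar> + D * (\<Sum>i\<in>I. \<bar>x i\<bar>))"
      unfolding real_norm_def by (intro AE_I2 order_trans[OF D[OF x] abs_ge_self])
  qed
  define p' where "p' x = (\<integral>\<^sup>+a. p (x(j := a)) \<partial>std_gauss)" for x
  define h' where "h' x = (\<integral>b. h (x(j := b)) \<partial>std_gauss)" for x
  have pair: "(\<lambda>(x, a). x(j := a)) \<in> ?P \<Otimes>\<^sub>M std_gauss \<rightarrow>\<^sub>M (\<Pi>\<^sub>M i\<in>insert j I. std_gauss)"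
    by (rule measurable_add_dim)
  have "(\<integral>\<^sup>+x. p x \<partial>(\<Pi>\<^sub>M i\<in>insert j I. std_gauss)) = (\<integral>\<^sup>+x. p' x \<partial>?P)"
    unfolding p'_def using fin j by (rule gauss.product_nn_integral_insert) measurable
  also have "\<dots> \<le> ennreal (exp (\<integral>x. h' x \<partial>?P))"
  proof (rule insert.IH)
    have "case_prod (\<lambda>x a. p (x(j := a))) \<in> borel_measurable (?P \<Otimes>\<^sub>M std_gauss)"
      using measurable_compose[OF pair insert.prems(1)] by (simp add: case_prod_beta')
    then show "p' \<in> borel_measurable ?P"
      unfolding p'_def[abs_def] by (rule std_gauss.borel_measurable_nn_integral)
    have "case_prod (\<lambda>x a. h (x(j := a))) \<in> borel_measurable (?P \<Otimes>\<^sub>M std_gauss)"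
      using measurable_compose[OF pair insert.prems(2)] by (simp add: case_prod_beta')
    then show "h' \<in> borel_measurable ?P"
      unfolding h'_def[abs_def] by (rule std_gauss.borel_measurable_lebesgue_integral)
    show "\<bar>h' x\<bar> \<le> (C + D * (\<integral>b. \<bar>b\<bar> \<partial>std_gauss)) + D * (\<Sum>i\<in>I. \<bar>x i\<bar>)" if x: "x \<in> ?X" for x
    proof -
      have "\<bar>h' x\<bar> \<le> (\<integral>b. C + D * \<bar>b\<bar> + D * (\<Sum>i\<in>I. \<bar>x i\<bar>) \<partial>std_gauss)"
        unfolding h'_def
        by (rule order_trans[OF integral_abs_bound], rule integral_mono)
          (use D[OF x] int_slice[OF x] integrable_std_gauss_abs in auto)
      also have "\<dots> = (C + D * (\<integral>b. \<bar>b\<bar> \<partial>std_gauss)) + D * (\<Sum>i\<in>I. \<bar>x i\<bar>)"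
        using integrable_std_gauss_abs std_gauss.prob_space by simp
      finally show ?thesis .
    qed
    show "p' x \<le> ennreal (exp (h' y + (1 - t) / 2 * (\<Sum>i\<in>I. (x i - y i)\<^sup>2)))"
      if x: "x \<in> ?X" and y: "y \<in> ?X" for x y
    proof -
      \<comment> \<open>The distance in the old coordinates does not involve the new one, so it
        joins \<open>h\<close> as an additive constant.\<close>
      let ?d = "(1 - t) / 2 * (\<Sum>i\<in>I. (x i - y i)\<^sup>2)"
      have "p' x \<le> ennreal (exp (\<integral>b. h (y(j := b)) + ?d \<partial>std_gauss))"
        unfolding p'_def
      proof (rule std_gauss_transport[OF t])
        show "(\<lambda>a. p (x(j := a))) \<in> borel_measurable borel"
          using measurable_compose[OF slice[OF x] insert.prems(1)] by (simp add: fun_upd_def cong: measurable_cong_sets)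
        show "integrable std_gauss (\<lambda>b. h (y(j := b)) + ?d)"
          using int_slice[OF y] by simp
        show "p (x(j := a)) \<le> ennreal (exp (h (y(j := b)) + ?d + (1 - t) / 2 * (a - b)\<^sup>2))" for a b
        proof -
          have sum: "(\<Sum>i\<in>insert j I. ((x(j := a)) i - (y(j := b)) i)\<^sup>2) = (a - b)\<^sup>2 + (\<Sum>i\<in>I. (x i - y i)\<^sup>2)"
            by (rule upd_sum)
          show ?thesis
            using insert.prems(4)[OF upd[OF x, of a] upd[OF y, of b]] unfolding sum
            by (simp only: distrib_left add_ac)
        qed
      qed
      also have "(\<integral>b. h (y(j := b)) + ?d \<partial>std_gauss) = h' y + ?d"
        unfolding h'_def using int_slice[OF y] std_gauss.prob_space by simp
      finally show ?thesis .
    qed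
  qed
  also have "(\<integral>x. h' x \<partial>?P) = (\<integral>x. h x \<partial>(\<Pi>\<^sub>M i\<in>insert j I. std_gauss))"
    unfolding h'_def using fin j insert.prems
    by (intro gauss.product_integral_insert[symmetric] integrable_PiM_std_gauss[where C=C and D=D]) auto
  finally show ?case .
qed

lemma nn_integral_exp_PiM_std_gauss:
  fixes b :: "nat \<Rightarrow> real"
  assumes "finite I"
  shows "(\<integral>\<^sup>+u. ennreal (exp (\<Sum>i\<in>I. b i * u i)) \<partial>(\<Pi>\<^sub>M i\<in>I. std_gauss)) = ennreal (exp ((\<Sum>i\<in>I. (b i)\<^sup>2) / 2))"
proof -
  have "(\<integral>\<^sup>+u. ennreal (exp (\<Sum>i\<in>I. b i * u i)) \<partial>(\<Pi>\<^sub>M i\<in>I. std_gauss))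
      = (\<integral>\<^sup>+u. (\<Prod>i\<in>I. ennreal (exp (b i * u i))) \<partial>(\<Pi>\<^sub>M i\<in>I. std_gauss))"
    by (simp add: exp_sum[OF assms] prod_ennreal)
  also have "\<dots> = (\<Prod>i\<in>I. \<integral>\<^sup>+x. ennreal (exp (b i * x)) \<partial>std_gauss)"
    using assms by (intro gauss.product_nn_integral_prod) auto
  also have "\<dots> = ennreal (exp ((\<Sum>i\<in>I. (b i)\<^sup>2) / 2))"
    by (simp add: nn_integral_exp_std_gauss prod_ennreal exp_sum[OF assms] sum_divide_distrib)
  finally show ?thesis .
qed

section \<open>The spaces \<open>Rn n\<close> and the Gaussian mean width\<close>

lemma coord_Rn_vec [simp]: "coord (Rn_vec n u) i = (if i < n then u i else 0)"
  by transfer simp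

lemma Rn_vec_coord: "x \<in> Rn n \<Longrightarrow> Rn_vec n (coord x) = x"
  by (rule fseq_eqI) (auto simp: Rn_def)

lemma ex_Rn: "\<exists>n. x \<in> Rn n"
proof -
  obtain k where "\<forall>i\<in>{i. coord x i \<noteq> 0}. i < k"
    using finite_nat_bounded[OF finite_coord] by blast
  then have "x \<in> Rn k" by (auto simp: Rn_def not_less[symmetric])
  then show ?thesis by blast
qed

text \<open>A finite sum of coordinates times fixed vectors. Continuity refers to the product
  topology on \<open>nat \<Rightarrow> real\<close>; through it density, compactness and
  measurability are carried over to \<open>Rn n\<close>.\<close>

lemma continuous_on_Rn_vec: "continuous_on UNIV (Rn_vec n)"
proof -
  define e where "e i = Rn_vec (Suc i) (\<lambda>j. if j = i then 1 else 0)" for i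
  have "Rn_vec n u = (\<Sum>i<n. u i *\<^sub>R e i)" for u
  proof (rule fseq_eqI)
    fix j
    have "coord (\<Sum>i<m. u i *\<^sub>R e i) j = (\<Sum>i<m. u i * coord (e i) j)" for m
      by (induction m) auto
    also have "(\<Sum>i<n. u i * coord (e i) j) = (\<Sum>i<n. if i = j then u i else 0)"
      by (intro sum.cong) (auto simp: e_def)
    finally show "coord (Rn_vec n u) j = coord (\<Sum>i<n. u i *\<^sub>R e i) j"
      by simp
  qed
  then have "Rn_vec n = (\<lambda>u. \<Sum>i<n. u i *\<^sub>R e i)" by blast
  then show ?thesis by (simp add: continuous_intros)
qed

text \<open>The images of a countable dense set of sequences under all \<open>Rn_vec n\<close> are
  dense, and balls of rational radius around them form a base. This serves the Lindelof argument for
  the support and the joint measurability of the inner product.\<close>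

instance fseq :: second_countable_topology
proof
  obtain D :: "(nat \<Rightarrow> real) set" where D: "countable D" "\<And>U. open U \<Longrightarrow> U \<noteq> {} \<Longrightarrow> \<exists>d\<in>D. d \<in> U"
    using countable_dense_exists[where 'a="nat \<Rightarrow> real"] by metis
  define E where "E = (\<Union>n. Rn_vec n ` D)"
  have E: "\<exists>y\<in>E. dist x y < e" if "0 < e" for x e
  proof -
    obtain n where n: "x \<in> Rn n" using ex_Rn by blast
    have "open (Rn_vec n -` ball x e)"
      by (rule continuous_open_vimage) (use continuous_on_Rn_vec in \<open>auto simp: continuous_on_eq_continuous_at\<close>)
    moreover have "coord x \<in> Rn_vec n -` ball x e" using n that by (simp add: Rn_vec_coord)
    ultimately obtain d where "d \<in> D" "d \<in> Rn_vec n -` ball x e" using D(2) by blast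
    then show ?thesis by (auto simp: E_def)
  qed
  define B where "B = (\<lambda>(y, q). ball y q) ` (E \<times> (\<rat> \<inter> {0<..}))"
  have "topological_basis B"
  proof (rule topological_basisI)
    fix U :: "fseq set" and x assume "open U" "x \<in> U"
    then obtain e where e: "0 < e" "ball x e \<subseteq> U" by (auto simp: open_contains_ball)
    obtain q :: real where q: "q \<in> \<rat>" "0 < q" "q < e / 2"
      using Rats_dense_in_real[of 0 "e / 2"] e by auto
    obtain y where y: "y \<in> E" "dist x y < q" using E q by blast
    have "ball y q \<subseteq> ball x e"
    proof
      fix z assume "z \<in> ball y q"
      then show "z \<in> ball x e" using dist_triangle[of x z y] y q by simp
    qed
    then show "\<exists>B'\<in>B. x \<in> B' \<and> B' \<subseteq> U"
      using e y q by (intro bexI[of _ "ball y q"]) (auto simp: B_def dist_commute)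
  qed (auto simp: B_def)
  moreover have "countable B"
    using D(1) by (auto simp: B_def E_def countable_rat)
  ultimately show "\<exists>B::fseq set set. countable B \<and> open = generate_topology B"
    using topological_basis_imp_subbasis by blast
qed

lemma subspace_Rn: "subspace (Rn n)"
  by (auto simp: subspace_def Rn_def)

lemma closed_Rn: "closed (Rn n)"
proof -
  have "Rn n = (\<Inter>i\<in>{n..}. {x. inner (Rn_vec (Suc i) (\<lambda>j. if j = i then 1 else 0)) x = 0})"
    by (auto simp: Rn_def inner_Rn[OF Rn_vec_in_Rn])
  also have "closed \<dots>" by (intro closed_INT ballI closed_hyperplane)
  finally show ?thesis .
qed

lemma inner_Rn_vec: "x \<in> Rn n \<Longrightarrow> inner x (Rn_vec n u) = (\<Sum>i<n. coord x i * u i)"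
  by (simp add: inner_Rn)

lemma norm_sq_Rn: "x \<in> Rn n \<Longrightarrow> (norm x)\<^sup>2 = (\<Sum>i<n. (coord x i)\<^sup>2)"
  unfolding power2_norm_eq_inner by (simp add: inner_Rn power2_eq_square)

text \<open>Heine-Borel inside \<open>Rn n\<close>: the coordinates of \<open>C\<close> lie in a
  cube, compact by Tychonoff's theorem, whose image under \<open>Rn_vec n\<close> contains
  \<open>C\<close>. In all of \<open>fseq\<close> closed bounded sets need not be compact.\<close>

lemma compact_Rn:
  assumes C: "C \<subseteq> Rn n" "closed C" "bounded C"
  shows "compact C"
proof -
  obtain R where R: "\<And>x. x \<in> C \<Longrightarrow> norm x \<le> R" using C(3) by (auto simp: bounded_iff)
  have "compactin (product_topology (\<lambda>_. euclidean) UNIV) (PiE UNIV (\<lambda>_::nat. {-R..R}))"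
    by (simp add: compactin_PiE)
  then have "compact (PiE UNIV (\<lambda>_::nat. {-R..R}))"
    by (simp add: euclidean_product_topology)
  then have "compact (Rn_vec n ` PiE UNIV (\<lambda>_. {-R..R}))"
    by (intro compact_continuous_image continuous_on_subset[OF continuous_on_Rn_vec]) auto
  moreover have "C \<subseteq> Rn_vec n ` PiE UNIV (\<lambda>_. {-R..R})"
  proof
    fix x assume x: "x \<in> C"
    have "\<bar>coord x i\<bar> \<le> R" for i
    proof -
      have "inner (Rn_vec (Suc i) (\<lambda>j. if j = i then 1 else 0)) x = coord x i"
        by (simp add: inner_Rn[OF Rn_vec_in_Rn] if_distrib[of "\<lambda>r. r * _"] cong: if_cong)
      moreover have "norm (Rn_vec (Suc i) (\<lambda>j. if j = i then 1 else 0)) = 1"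
        by (simp add: norm_eq_sqrt_inner inner_Rn[OF Rn_vec_in_Rn] if_distrib[of "\<lambda>r. r * _"] cong: if_cong)
      ultimately show ?thesis
        using Cauchy_Schwarz_ineq2[of "Rn_vec (Suc i) (\<lambda>j. if j = i then 1 else 0)" x] R[OF x] by simp
    qed
    then show "x \<in> Rn_vec n ` PiE UNIV (\<lambda>_. {-R..R})"
      using x C(1) by (intro image_eqI[of _ _ "coord x"]) (auto simp: Rn_vec_coord abs_le_iff minus_le_iff)
  qed
  ultimately show ?thesis using C(2) by (metis compact_Int_closed inf.absorb_iff2)
qed

text \<open>Elements of the product over \<open>{..<n}\<close> are \<open>undefined\<close>
  elsewhere. Overwriting this by 0 gives a measurable map into all sequences and leaves
  \<open>Rn_vec n u\<close> unchanged, so that continuity applies.\<close>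

lemma measurable_Rn_vec [measurable]:
  "Rn_vec n \<in> (\<Pi>\<^sub>M i\<in>{..<n}. std_gauss) \<rightarrow>\<^sub>M borel"
proof -
  have ext: "Rn_vec n u = Rn_vec n (\<lambda>i. if i < n then u i else 0)" for u
    by (rule fseq_eqI) simp
  have cont: "Rn_vec n \<in> borel \<rightarrow>\<^sub>M borel"
    by (rule borel_measurable_continuous_onI[OF continuous_on_Rn_vec])
  have "(\<lambda>u i. if i < n then u i else 0) \<in> (\<Pi>\<^sub>M i\<in>{..<n}. std_gauss) \<rightarrow>\<^sub>M (borel :: (nat \<Rightarrow> real) measure)"
  proof (rule measurable_coordinatewise_then_product)
    fix i
    show "(\<lambda>u. if i < n then u i else 0) \<in> (\<Pi>\<^sub>M i\<in>{..<n}. std_gauss) \<rightarrow>\<^sub>M (borel :: real measure)"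
      by (cases "i < n") auto
  qed
  from measurable_compose[OF this cont] show ?thesis by (simp flip: ext)
qed

section \<open>Suprema of affine functions and the mass of a supremum of Gaussian densities\<close>

text \<open>The offset \<open>c\<close> covers at once the support function (\<open>c = 0\<close>)
  and the supremum with quadratic penalty. The bounds \<open>R\<close> and \<open>B\<close> make the
  real-valued supremum finite.\<close>

lemma SUP_affine_le:
  fixes A :: "'a::real_inner set"
  assumes A: "\<And>a. a \<in> A \<Longrightarrow> norm a \<le> R" and c: "\<And>a. a \<in> A \<Longrightarrow> c a \<le> B" and a: "a \<in> A"
  shows "inner a z + c a \<le> (SUP a\<in>A. inner a z + c a)"
proof (rule cSUP_upper[OF a])
  have "inner a z + c a \<le> R * norm z + B" if "a \<in> A" for a
    using norm_cauchy_schwarz[of a z] mult_right_mono[OF A[OF that] norm_ge_zero[of z]] c[OF that] by linarith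
  then show "bdd_above ((\<lambda>a. inner a z + c a) ` A)" by (rule bdd_aboveI2)
qed

lemma SUP_affine_lipschitz:
  fixes A :: "'a::real_inner set"
  assumes "A \<noteq> {}" and A: "\<And>a. a \<in> A \<Longrightarrow> norm a \<le> R" and c: "\<And>a. a \<in> A \<Longrightarrow> c a \<le> B"
  shows "\<bar>(SUP a\<in>A. inner a z + c a) - (SUP a\<in>A. inner a z' + c a)\<bar> \<le> R * norm (z - z')"
proof -
  have "(SUP a\<in>A. inner a z + c a) \<le> (SUP a\<in>A. inner a z' + c a) + R * norm (z - z')" for z z'
  proof (rule cSUP_least[OF \<open>A \<noteq> {}\<close>])
    fix a assume a: "a \<in> A"
    have "inner a z + c a = inner a z' + c a + inner a (z - z')" by (simp add: inner_diff_right)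
    also have "\<dots> \<le> (SUP a\<in>A. inner a z' + c a) + R * norm (z - z')"
      using SUP_affine_le[OF A c a] norm_cauchy_schwarz[of a "z - z'"]
        mult_right_mono[OF A[OF a] norm_ge_zero[of "z - z'"]]
      by (intro add_mono) auto
    finally show "inner a z + c a \<le> (SUP a\<in>A. inner a z' + c a) + R * norm (z - z')" .
  qed
  from this[of z z'] this[of z' z] show ?thesis by (simp add: abs_le_iff norm_minus_commute)
qed

lemma continuous_on_SUP_affine:
  fixes A :: "'a::real_inner set"
  assumes "A \<noteq> {}" "\<And>a. a \<in> A \<Longrightarrow> norm a \<le> R" "\<And>a. a \<in> A \<Longrightarrow> c a \<le> B"
  shows "continuous_on UNIV (\<lambda>z. SUP a\<in>A. inner a z + c a)"
proof -
  have "0 \<le> R" using assms(1,2) norm_ge_zero order_trans by blast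
  have "R-lipschitz_on UNIV (\<lambda>z. SUP a\<in>A. inner a z + c a)"
    using SUP_affine_lipschitz[of A R c B, OF assms] \<open>0 \<le> R\<close>
    by (auto simp: lipschitz_on_def dist_real_def dist_norm)
  then show ?thesis by (rule lipschitz_on_continuous_on)
qed

lemma gaussian_mean_width_std_gauss:
  "gaussian_mean_width n V = (\<integral>u. (SUP z\<in>V. inner z (Rn_vec n u)) \<partial>(\<Pi>\<^sub>M i\<in>{..<n}. std_gauss))"
  by (simp add: gaussian_mean_width_def std_gauss_def)

text \<open>The integrand is the supremum over \<open>w\<close> in \<open>W\<close> of the density
  of the Gaussian of variance \<open>s\<^sup>2\<close> around \<open>w\<close> relative to the
  centred one, at \<open>s\<close> times \<open>Rn_vec n u\<close>. The transport inequality is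
  applied with the support function of \<open>W\<close> divided by \<open>s\<close>.\<close>

lemma exp_SUP_le_gaussian_mean_width:
  assumes W: "W \<noteq> {}" "W \<subseteq> Rn n" and R: "\<And>w. w \<in> W \<Longrightarrow> norm w \<le> R" and s: "0 < s"
  shows "(\<integral>\<^sup>+u. ennreal (exp (SUP w\<in>W. inner w (Rn_vec n u /\<^sub>R s) + - ((norm w)\<^sup>2 / (2 * s\<^sup>2))))
      \<partial>(\<Pi>\<^sub>M i\<in>{..<n}. std_gauss)) \<le> ennreal (exp (gaussian_mean_width n W / s))"
    (is "?I \<le> ennreal (exp ?L)")
proof -
  let ?P = "\<Pi>\<^sub>M i\<in>{..<n}. std_gauss"
  \<comment> \<open>The factor \<open>1 / (1 - t)\<close> in the penalty matches the cost
    \<open>(1 - t) / 2\<close> of the transport inequality; \<open>t = 0\<close> gives the penalty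
    of the claim.\<close>
  define S where "S t z = (SUP w\<in>W. inner w z + - ((norm w)\<^sup>2 / (2 * s\<^sup>2 * (1 - t))))" for t z
  define h where "h z = (SUP w\<in>W. inner w z)" for z
  have R2: "(norm w)\<^sup>2 \<le> R\<^sup>2" if "w \<in> W" for w using R[OF that] by (intro power_mono) auto
  have h_le: "inner w z \<le> h z" if "w \<in> W" for w z
    using SUP_affine_le[of W R "\<lambda>_. 0" 0, OF R _ that] by (simp add: h_def)
  have h_bound: "\<bar>h z\<bar> \<le> R * norm z" for z
    using SUP_affine_lipschitz[of W R "\<lambda>_. 0" 0 z 0, OF W(1) R] W(1) by (simp add: h_def)
  have [measurable]: "h \<in> borel_measurable borel"
    unfolding h_def[abs_def] using continuous_on_SUP_affine[of W R "\<lambda>_. 0" 0, OF W(1) R]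
    by (intro borel_measurable_continuous_onI) simp
  have S_cont: "continuous_on UNIV (S t)" if "t < 1" for t
    unfolding S_def using that by (intro continuous_on_SUP_affine[where B=0 and R=R] W R) auto
  have S_le: "inner w z + - ((norm w)\<^sup>2 / (2 * s\<^sup>2 * (1 - t))) \<le> S t z" if "w \<in> W" "t < 1" for w z t
    unfolding S_def by (rule SUP_affine_le[OF R _ that(1), where B=0]) (use that in auto)
  have *: "(\<integral>\<^sup>+u. ennreal (exp (S t (Rn_vec n u /\<^sub>R s))) \<partial>?P) \<le> ennreal (exp ?L)" if t: "0 < t" "t < 1" for t
  proof -
    have [measurable]: "S t \<in> borel_measurable borel"
      by (rule borel_measurable_continuous_onI[OF S_cont]) (use t in auto)
    have "(\<integral>\<^sup>+u. ennreal (exp (S t (Rn_vec n u /\<^sub>R s))) \<partial>?P) \<le> ennreal (exp (\<integral>u. h (Rn_vec n u) / s \<partial>?P))"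
    proof (rule std_gauss_transport_PiM[OF _ t, where C=0 and D="R / s"])
      fix y :: "nat \<Rightarrow> real"
      have R0: "0 \<le> R" using W(1) R norm_ge_zero order_trans by blast
      have "norm (Rn_vec n y) \<le> (\<Sum>i<n. \<bar>y i\<bar>)"
      proof -
        have "norm (Rn_vec n y) = L2_set y {..<n}"
          unfolding L2_set_def using norm_sq_Rn[OF Rn_vec_in_Rn[of n y]]
          by (intro real_sqrt_unique[symmetric]) auto
        then show ?thesis by (simp add: L2_set_le_sum_abs)
      qed
      then have "\<bar>h (Rn_vec n y)\<bar> \<le> R * (\<Sum>i<n. \<bar>y i\<bar>)"
        using h_bound[of "Rn_vec n y"] mult_left_mono[OF _ R0] by (meson order_trans)
      then show "\<bar>h (Rn_vec n y) / s\<bar> \<le> 0 + R / s * (\<Sum>i<n. \<bar>y i\<bar>)"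
        using s by (simp add: divide_right_mono)
    next
      fix x y :: "nat \<Rightarrow> real"
      let ?x = "Rn_vec n x" and ?y = "Rn_vec n y"
      have "(\<Sum>i<n. (x i - y i)\<^sup>2) = (norm (?x - ?y))\<^sup>2"
        by (subst norm_sq_Rn[of _ n]) (auto intro: subspace_diff[OF subspace_Rn] Rn_vec_in_Rn)
      moreover have "S t (?x /\<^sub>R s) \<le> h ?y / s + (1 - t) / 2 * (norm (?x - ?y))\<^sup>2"
        unfolding S_def
      proof (rule cSUP_least[OF W(1)])
        fix w assume w: "w \<in> W"
        define a b where "a = norm w / s" and "b = norm (?x - ?y)"
        have "inner w (?x /\<^sub>R s) = inner w ?y / s + inner w (?x - ?y) / s"
          by (simp add: inner_diff_right divide_inverse algebra_simps)
        also have "\<dots> \<le> h ?y / s + a * b"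
          using h_le[OF w, of ?y] norm_cauchy_schwarz[of w "?x - ?y"] s
          by (intro add_mono) (auto simp: a_def b_def divide_right_mono)
        \<comment> \<open>Young's inequality with weight \<open>1 - t\<close>: the first term is the
          penalty, the second the transport cost.\<close>
        also have "a * b \<le> a\<^sup>2 / (2 * (1 - t)) + (1 - t) / 2 * b\<^sup>2"
        proof -
          have "0 \<le> (a - (1 - t) * b)\<^sup>2 / (2 * (1 - t))" using t by simp
          also have "\<dots> = a\<^sup>2 / (2 * (1 - t)) + (1 - t) / 2 * b\<^sup>2 - a * b"
            using t by (simp add: power2_eq_square field_simps)
          finally show ?thesis by simp
        qed
        also have "a\<^sup>2 / (2 * (1 - t)) = (norm w)\<^sup>2 / (2 * s\<^sup>2 * (1 - t))"
          by (simp add: a_def power_divide mult_ac)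
        finally show "inner w (?x /\<^sub>R s) + - ((norm w)\<^sup>2 / (2 * s\<^sup>2 * (1 - t)))
            \<le> h ?y / s + (1 - t) / 2 * (norm (?x - ?y))\<^sup>2"
          by (simp add: b_def)
      qed
      ultimately show "ennreal (exp (S t (?x /\<^sub>R s))) \<le> ennreal (exp (h ?y / s + (1 - t) / 2 * (\<Sum>i<n. (x i - y i)\<^sup>2)))"
        by (simp add: ennreal_leI)
    qed (simp, measurable)
    also have "(\<integral>u. h (Rn_vec n u) / s \<partial>?P) = ?L"
      by (simp add: gaussian_mean_width_std_gauss h_def)
    finally show ?thesis .
  qed
  \<comment> \<open>An upper bound for the penalty on \<open>W\<close>. It makes the comparison of
    \<open>S 0\<close> with \<open>S t\<close> uniform, with an error that vanishes as
    \<open>t\<close> tends to 0.\<close>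
  define B where "B = R\<^sup>2 / (2 * s\<^sup>2)"
  have S0_le: "S 0 z \<le> S t z + B * (1 / (1 - t) - 1)" if t: "0 < t" "t < 1" for t z
    unfolding S_def[of 0]
  proof (rule cSUP_least[OF W(1)])
    fix w assume w: "w \<in> W"
    have "(norm w)\<^sup>2 / (2 * s\<^sup>2) * (1 / (1 - t) - 1) \<le> B * (1 / (1 - t) - 1)"
      unfolding B_def using t s R2[OF w] by (intro mult_right_mono divide_right_mono) (auto simp: field_simps)
    moreover have "(norm w)\<^sup>2 / (2 * s\<^sup>2 * (1 - t)) = (norm w)\<^sup>2 / (2 * s\<^sup>2) * (1 / (1 - t))"
      by simp
    ultimately show "inner w z + - ((norm w)\<^sup>2 / (2 * s\<^sup>2 * (1 - 0))) \<le> S t z + B * (1 / (1 - t) - 1)"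
      using S_le[OF w t(2), of z] by (simp add: right_diff_distrib)
  qed
  have I: "?I \<le> ennreal (exp (B * (1 / (1 - t) - 1)) * exp ?L)" if t: "0 < t" "t < 1" for t
  proof -
    have [measurable]: "S t \<in> borel_measurable borel"
      by (rule borel_measurable_continuous_onI[OF S_cont]) (use t in auto)
    have "?I = (\<integral>\<^sup>+u. ennreal (exp (S 0 (Rn_vec n u /\<^sub>R s))) \<partial>?P)" by (simp add: S_def)
    also have "\<dots> \<le> (\<integral>\<^sup>+u. ennreal (exp (B * (1 / (1 - t) - 1))) * ennreal (exp (S t (Rn_vec n u /\<^sub>R s))) \<partial>?P)"
      using S0_le[OF t] by (intro nn_integral_mono) (simp add: ennreal_leI add.commute flip: ennreal_mult exp_add)
    also have "\<dots> = ennreal (exp (B * (1 / (1 - t) - 1))) * (\<integral>\<^sup>+u. ennreal (exp (S t (Rn_vec n u /\<^sub>R s))) \<partial>?P)"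
      by (rule nn_integral_cmult) measurable
    also have "\<dots> \<le> ennreal (exp (B * (1 / (1 - t) - 1))) * ennreal (exp ?L)"
      by (intro mult_left_mono *[OF t]) simp
    finally show ?thesis by (simp add: ennreal_mult)
  qed
  have "((\<lambda>t. ennreal (exp (B * (1 / (1 - t) - 1)) * exp ?L)) \<longlongrightarrow> ennreal (exp (B * (1 / (1 - 0) - 1)) * exp ?L)) (at_right 0)"
    by (intro tendsto_intros) auto
  then have "((\<lambda>t. ennreal (exp (B * (1 / (1 - t) - 1)) * exp ?L)) \<longlongrightarrow> ennreal (exp ?L)) (at_right 0)"
    by simp
  moreover have "\<forall>\<^sub>F t in at_right (0::real). ?I \<le> ennreal (exp (B * (1 / (1 - t) - 1)) * exp ?L)"
    by (rule eventually_at_rightI[of 0 1]) (use I in auto)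
  ultimately show ?thesis
    by (rule tendsto_lowerbound) simp
qed

section \<open>Tilted measures\<close>

locale compact_prob_Rn = prob_space \<mu> for \<mu> :: "fseq measure" +
  fixes n :: nat
  assumes sets_eq: "sets \<mu> = sets (restrict_space borel (Rn n))"
    and compact_support: "compact (measure_support \<mu>)"
begin

abbreviation S :: "fseq set" where "S \<equiv> measure_support \<mu>"

lemma space_eq: "space \<mu> = Rn n"
  using sets_eq_imp_space_eq[OF sets_eq] by (simp add: space_restrict_space)

lemma support_subset: "S \<subseteq> Rn n"
  by (auto simp: measure_support_def space_eq)

lemma measurable_continuous: "continuous_on (Rn n) f \<Longrightarrow> f \<in> borel_measurable \<mu>"
  for f :: "fseq \<Rightarrow> 'b::topological_space"
  using borel_measurable_continuous_on_restrict[of "Rn n" f]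
  by (simp add: measurable_cong_sets[OF sets_eq refl])

lemma measurable_self [measurable]: "(\<lambda>x. x) \<in> borel_measurable \<mu>"
  by (rule measurable_continuous) simp

text \<open>The complement of the support in \<open>Rn n\<close> is covered by open sets of measure
  0, and by Lindelof countably many of them suffice.\<close>

lemma AE_support: "AE x in \<mu>. x \<in> S"
proof -
  define \<F> where "\<F> = {U. open U \<and> emeasure \<mu> (U \<inter> Rn n) = 0}"
  obtain \<G> where \<G>: "\<G> \<subseteq> \<F>" "countable \<G>" "\<Union>\<G> = \<Union>\<F>"
    using Lindelof[of \<F>] by (auto simp: \<F>_def)
  have sets: "U \<inter> Rn n \<in> sets \<mu>" if "open U" for U
    using that closed_Rn by (auto simp: sets_eq sets_restrict_space)
  have "AE x in \<mu>. \<forall>U\<in>\<G>. x \<notin> U"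
  proof (subst AE_ball_countable[OF \<G>(2)], intro ballI)
    fix U assume "U \<in> \<G>"
    then have U: "open U" "emeasure \<mu> (U \<inter> Rn n) = 0" using \<G>(1) by (auto simp: \<F>_def)
    have "AE x in \<mu>. x \<notin> U \<inter> Rn n"
      by (rule AE_not_in) (use U sets in \<open>auto simp: null_sets_def\<close>)
    then show "AE x in \<mu>. x \<notin> U"
      using AE_space by eventually_elim (auto simp: space_eq)
  qed
  then show ?thesis
    using AE_space
  proof eventually_elim
    case (elim x)
    then have "x \<notin> \<Union>\<F>" using \<G>(3) by auto
    then show ?case using elim(2)
      by (auto simp: measure_support_def space_eq \<F>_def zero_less_iff_neq_zero)
  qed
qed

lemma support_nonempty: "S \<noteq> {}"
  using AE_support AE_False by force

lemma support_bounded: obtains R where "0 < R" "\<And>x. x \<in> S \<Longrightarrow> norm x \<le> R"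
  using compact_imp_bounded[OF compact_support] by (auto simp: bounded_pos)

lemma integrable_continuous:
  fixes f :: "fseq \<Rightarrow> real"
  assumes "continuous_on (Rn n) f"
  shows "integrable \<mu> f"
proof -
  have "compact (f ` S)"
    by (rule compact_continuous_image[OF continuous_on_subset[OF assms support_subset] compact_support])
  then obtain B where "\<And>x. x \<in> S \<Longrightarrow> \<bar>f x\<bar> \<le> B"
    using compact_imp_bounded by (force simp: bounded_iff)
  then show ?thesis
    using AE_support measurable_continuous[OF assms]
    by (intro integrable_const_bound[of f B]) (auto elim: eventually_mono)
qed

lemma integral_exp_pos:
  fixes f :: "fseq \<Rightarrow> real"
  assumes f: "continuous_on (Rn n) f"
  shows "0 < (\<integral>x. exp (f x) \<partial>\<mu>)"
proof -
  have "exp (\<integral>x. f x \<partial>\<mu>) \<le> (\<integral>x. exp (f x) \<partial>\<mu>)"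
    using exp_integral_le[OF integrable_continuous[OF f]] integrable_continuous[OF continuous_on_exp[OF f]]
    by (simp add: nn_integral_eq_integral)
  then show ?thesis using exp_gt_zero[of "\<integral>x. f x \<partial>\<mu>"] by linarith
qed

abbreviation \<Lambda> :: "fseq \<Rightarrow> real" where "\<Lambda> \<equiv> log_laplace \<mu>"

lemma exp_log_laplace: "exp (\<Lambda> t) = (\<integral>x. exp (inner t x) \<partial>\<mu>)"
  unfolding log_laplace_def by (simp add: integral_exp_pos continuous_intros)

lemma nn_integral_exp_inner: "(\<integral>\<^sup>+x. ennreal (exp (inner t x)) \<partial>\<mu>) = ennreal (exp (\<Lambda> t))"
  unfolding exp_log_laplace
  by (intro nn_integral_eq_integral integrable_continuous) (auto intro!: continuous_intros)

text \<open>If the support lies in the ball of radius \<open>R\<close>, a change of tilt from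
  \<open>u\<close> to \<open>t\<close> multiplies the integrand by at most
  \<open>exp (R * norm (t - u))\<close>, so \<open>\<Lambda>\<close> is Lipschitz.\<close>

lemma continuous_on_log_laplace: "continuous_on UNIV \<Lambda>"
proof -
  obtain R where R: "0 < R" "\<And>x. x \<in> S \<Longrightarrow> norm x \<le> R"
    using support_bounded by blast
  have le: "\<Lambda> t \<le> \<Lambda> u + R * norm (t - u)" for t u
  proof -
    have "(\<integral>x. exp (inner t x) \<partial>\<mu>) \<le> (\<integral>x. exp (R * norm (t - u)) * exp (inner u x) \<partial>\<mu>)"
    proof (rule integral_mono_AE)
      show "AE x in \<mu>. exp (inner t x) \<le> exp (R * norm (t - u)) * exp (inner u x)"
        using AE_support
      proof eventually_elim
        case (elim x)
        have "inner t x = inner (t - u) x + inner u x" by (simp add: inner_diff_left)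
        also have "inner (t - u) x \<le> R * norm (t - u)"
          using norm_cauchy_schwarz[of "t - u" x] mult_left_mono[OF R(2)[OF elim] norm_ge_zero[of "t - u"]]
          by (simp add: mult.commute)
        finally show ?case by (simp flip: exp_add)
      qed
    qed (auto intro!: integrable_continuous continuous_intros)
    then have "exp (\<Lambda> t) \<le> exp (\<Lambda> u + R * norm (t - u))"
      by (simp add: exp_log_laplace exp_add mult.commute)
    then show ?thesis by simp
  qed
  have "R-lipschitz_on UNIV \<Lambda>"
  proof (rule lipschitz_onI)
    show "dist (\<Lambda> t) (\<Lambda> u) \<le> R * dist t u" for t u
      using le[of t u] le[of u t] by (simp add: dist_real_def dist_norm abs_le_iff norm_minus_commute)
  qed (use R in simp)
  then show ?thesis by (rule lipschitz_on_continuous_on)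
qed

lemma measurable_log_laplace [measurable]: "\<Lambda> \<in> borel_measurable borel"
  by (rule borel_measurable_continuous_onI[OF continuous_on_log_laplace])

section \<open>The tilted mean as gradient of the logarithmic Laplace transform\<close>

text \<open>The gradient of \<open>\<Lambda>\<close> at \<open>l\<close>, as the mean of the
  probability measure with density \<open>exp (inner l x - \<Lambda> l)\<close>. It is given by
  coordinates, so that only real integrals occur.\<close>

definition tilted_mean :: "fseq \<Rightarrow> fseq"
  where "tilted_mean l = Rn_vec n (\<lambda>i. \<integral>x. coord x i * exp (inner l x - \<Lambda> l) \<partial>\<mu>)"

lemma tilted_mean_in_Rn: "tilted_mean l \<in> Rn n"
  by (simp add: tilted_mean_def Rn_vec_in_Rn)

lemma continuous_on_coord: "continuous_on A (\<lambda>x. coord x i)"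
proof -
  have "coord x i = inner (Rn_vec (Suc i) (\<lambda>j. if j = i then 1 else 0)) x" for x
    by (simp add: inner_Rn[OF Rn_vec_in_Rn] if_distrib[of "\<lambda>r. r * _"] cong: if_cong)
  then show ?thesis by (simp add: continuous_intros)
qed

text \<open>The tilted density has total mass 1, so an affine function integrates to its value at
  the tilted mean. The estimates below rest on this identity.\<close>

lemma integral_tilted_affine:
  "(\<integral>x. (c + inner d x) * exp (inner l x - \<Lambda> l) \<partial>\<mu>) = c + inner d (tilted_mean l)"
proof -
  let ?r = "\<lambda>x. exp (inner l x - \<Lambda> l)"
  have int: "integrable \<mu> (\<lambda>x. coord x i * ?r x)" for i
    by (intro integrable_continuous continuous_intros continuous_on_coord)
  have "(\<integral>x. inner d x * ?r x \<partial>\<mu>) = (\<integral>x. (\<Sum>i<n. coord d i * (coord x i * ?r x)) \<partial>\<mu>)"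
    by (intro Bochner_Integration.integral_cong)
      (auto simp: space_eq inner_commute[of d] inner_Rn sum_distrib_left sum_distrib_right mult_ac)
  also have "\<dots> = (\<Sum>i<n. coord d i * (\<integral>x. coord x i * ?r x \<partial>\<mu>))"
    using int by simp
  also have "\<dots> = inner d (tilted_mean l)"
    unfolding inner_commute[of d] inner_Rn[OF tilted_mean_in_Rn]
    by (simp add: tilted_mean_def mult.commute)
  finally have 1: "(\<integral>x. inner d x * ?r x \<partial>\<mu>) = inner d (tilted_mean l)" .
  have 2: "(\<integral>x. ?r x \<partial>\<mu>) = 1"
    by (simp add: exp_diff flip: exp_log_laplace)
  have "(\<integral>x. (c + inner d x) * ?r x \<partial>\<mu>) = (\<integral>x. c * ?r x + inner d x * ?r x \<partial>\<mu>)"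
    by (simp add: distrib_right)
  also have "\<dots> = c + inner d (tilted_mean l)"
    by (subst Bochner_Integration.integral_add)
      (auto intro!: integrable_continuous continuous_intros simp: 1 2)
  finally show ?thesis .
qed

lemma exp_log_laplace_diff:
  "exp (\<Lambda> t - \<Lambda> l) = (\<integral>x. exp (inner (t - l) x) * exp (inner l x - \<Lambda> l) \<partial>\<mu>)"
  by (simp add: exp_diff exp_log_laplace[of t] inner_diff_left)

text \<open>Convexity of \<open>\<Lambda>\<close>, by Jensen for the tilted measure: the tangent of
  \<open>exp\<close> at \<open>m\<close> is integrated in place of
  \<open>exp (inner (t - l) x)\<close>.\<close>

lemma log_laplace_ge_tangent: "\<Lambda> l + inner (t - l) (tilted_mean l) \<le> \<Lambda> t"
proof -
  define m where "m = inner (t - l) (tilted_mean l)"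
  have "exp m = exp m * (\<integral>x. ((1 - m) + inner (t - l) x) * exp (inner l x - \<Lambda> l) \<partial>\<mu>)"
    unfolding integral_tilted_affine by (simp add: m_def)
  also have "\<dots> = (\<integral>x. exp m * (((1 - m) + inner (t - l) x) * exp (inner l x - \<Lambda> l)) \<partial>\<mu>)"
    by simp
  also have "\<dots> \<le> (\<integral>x. exp (inner (t - l) x) * exp (inner l x - \<Lambda> l) \<partial>\<mu>)"
  proof (rule integral_mono)
    fix x
    have "exp m * ((1 - m) + inner (t - l) x) \<le> exp (inner (t - l) x)"
    proof -
      have "exp m * (1 + (inner (t - l) x - m)) \<le> exp m * exp (inner (t - l) x - m)"
        by (intro mult_left_mono exp_ge_add_one_self) simp
      also have "\<dots> = exp (inner (t - l) x)" by (simp flip: exp_add)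
      finally show ?thesis by (simp add: algebra_simps)
    qed
    then show "exp m * (((1 - m) + inner (t - l) x) * exp (inner l x - \<Lambda> l))
        \<le> exp (inner (t - l) x) * exp (inner l x - \<Lambda> l)"
      by (simp add: mult.assoc[symmetric] mult_right_mono)
  qed (auto intro!: integrable_continuous continuous_intros)
  finally have "exp m \<le> exp (\<Lambda> t - \<Lambda> l)" by (simp add: exp_log_laplace_diff)
  then show ?thesis by (simp add: m_def)
qed

text \<open>By the tangent inequality \<open>t = l\<close> attains the supremum, so the transform is
  finite and explicit at tilted means.\<close>

lemma legendre_tilted_mean:
  assumes "l \<in> Rn n"
  shows "legendre n \<Lambda> (tilted_mean l) = ereal (inner l (tilted_mean l) - \<Lambda> l)"
  unfolding legendre_def
proof (rule antisym)
  show "(SUP t\<in>Rn n. ereal (inner t (tilted_mean l) - \<Lambda> t)) \<le> ereal (inner l (tilted_mean l) - \<Lambda> l)"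
    by (rule SUP_least) (use log_laplace_ge_tangent[of l] in \<open>simp add: inner_diff_left algebra_simps\<close>)
  show "ereal (inner l (tilted_mean l) - \<Lambda> l) \<le> (SUP t\<in>Rn n. ereal (inner t (tilted_mean l) - \<Lambda> t))"
    by (rule SUP_upper) fact
qed

text \<open>A one-sided second order bound, from \<open>exp u \<le> 1 + u + 2 * u\<^sup>2\<close>
  for \<open>u \<le> 1 / 2\<close>, in place of differentiation under the integral. It matters only
  that the remainder is of order \<open>s\<^sup>2\<close>.\<close>

lemma log_laplace_le_quadratic:
  assumes R: "\<And>x. x \<in> S \<Longrightarrow> \<bar>inner d x\<bar> \<le> R" and s: "0 \<le> s" "s * R \<le> 1 / 2"
  shows "\<Lambda> (l + s *\<^sub>R d) - \<Lambda> l \<le> s * inner d (tilted_mean l) + 2 * s\<^sup>2 * R\<^sup>2"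
proof -
  have exp_le: "exp u \<le> 1 + u + 2 * u\<^sup>2" if "u \<le> 1 / 2" for u :: real
  proof -
    have "exp u * (1 - u) \<le> exp u * exp (- u)"
      using exp_ge_add_one_self[of "- u"] by (intro mult_left_mono) auto
    then have "exp u * (1 - u) \<le> 1" by (simp flip: exp_add)
    then have "exp u \<le> 1 / (1 - u)" using that by (simp add: field_simps)
    also have "1 / (1 - u) \<le> 1 + u + 2 * u\<^sup>2"
    proof -
      have "0 \<le> u\<^sup>2 * (1 - 2 * u)" using that by simp
      then have "1 \<le> (1 + u + 2 * u\<^sup>2) * (1 - u)" by (simp add: power2_eq_square algebra_simps)
      then show ?thesis using that by (simp add: divide_le_eq)
    qed
    finally show ?thesis .
  qed
  have "\<Lambda> (l + s *\<^sub>R d) - \<Lambda> l \<le> exp (\<Lambda> (l + s *\<^sub>R d) - \<Lambda> l) - 1"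
    using exp_ge_add_one_self[of "\<Lambda> (l + s *\<^sub>R d) - \<Lambda> l"] by linarith
  also have "exp (\<Lambda> (l + s *\<^sub>R d) - \<Lambda> l) = (\<integral>x. exp (inner (s *\<^sub>R d) x) * exp (inner l x - \<Lambda> l) \<partial>\<mu>)"
    unfolding exp_log_laplace_diff by simp
  also have "\<dots> \<le> (\<integral>x. (1 + 2 * s\<^sup>2 * R\<^sup>2 + inner (s *\<^sub>R d) x) * exp (inner l x - \<Lambda> l) \<partial>\<mu>)"
  proof (rule integral_mono_AE)
    show "AE x in \<mu>. exp (inner (s *\<^sub>R d) x) * exp (inner l x - \<Lambda> l)
        \<le> (1 + 2 * s\<^sup>2 * R\<^sup>2 + inner (s *\<^sub>R d) x) * exp (inner l x - \<Lambda> l)"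
      using AE_support
    proof eventually_elim
      case (elim x)
      have "s * \<bar>inner d x\<bar> \<le> s * R" using R[OF elim] s by (intro mult_left_mono)
      then have abs: "\<bar>s * inner d x\<bar> \<le> s * R" using s by (simp add: abs_mult)
      then have "(s * inner d x)\<^sup>2 \<le> (s * R)\<^sup>2" by (rule abs_le_square_iff[THEN iffD1, OF order_trans]) simp
      moreover have "exp (s * inner d x) \<le> 1 + s * inner d x + 2 * (s * inner d x)\<^sup>2"
        using abs s by (intro exp_le) linarith
      ultimately show ?case by (intro mult_right_mono) (auto simp: power_mult_distrib)
    qed
  qed (auto intro!: integrable_continuous continuous_intros)
  also have "\<dots> = 1 + 2 * s\<^sup>2 * R\<^sup>2 + s * inner d (tilted_mean l)"
    unfolding integral_tilted_affine by simp
  finally show ?thesis by simp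
qed

text \<open>Maximality along the segment in direction \<open>d\<close>, divided by \<open>s\<close>,
  in the limit \<open>s\<close> to 0 from the right. The condition is one-sided, as \<open>l\<close>
  may lie on the boundary of the set on which it is maximal.\<close>

lemma tilted_mean_first_order:
  assumes max: "\<And>s. 0 \<le> s \<Longrightarrow> s \<le> 1 \<Longrightarrow>
    inner (l + s *\<^sub>R d) x - \<Lambda> (l + s *\<^sub>R d) \<le> inner l x - \<Lambda> l"
  shows "inner d x \<le> inner d (tilted_mean l)"
proof -
  obtain R where R: "0 < R" "\<And>x. x \<in> S \<Longrightarrow> norm x \<le> R"
    using support_bounded by blast
  \<comment> \<open>The summand 1 keeps \<open>Q\<close> positive also for
    \<open>d = 0\<close>.\<close>
  define Q where "Q = norm d * R + 1"
  have Q: "0 < Q" using R by (simp add: Q_def add_nonneg_pos)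
  have bound: "\<bar>inner d x\<bar> \<le> Q" if "x \<in> S" for x
    using Cauchy_Schwarz_ineq2[of d x] mult_left_mono[OF R(2)[OF that] norm_ge_zero[of d]]
    by (simp add: Q_def)
  have le: "inner d x \<le> inner d (tilted_mean l) + 2 * s * Q\<^sup>2" if s: "0 < s" "s < min 1 (1 / (2 * Q))" for s
  proof -
    have "s * Q \<le> 1 / 2" using s Q by (simp add: field_simps)
    then have "\<Lambda> (l + s *\<^sub>R d) - \<Lambda> l \<le> s * inner d (tilted_mean l) + 2 * s\<^sup>2 * Q\<^sup>2"
      using s by (intro log_laplace_le_quadratic bound) auto
    moreover have "s * inner d x \<le> \<Lambda> (l + s *\<^sub>R d) - \<Lambda> l"
      using max[of s] s by (simp add: inner_add_left)
    ultimately have "s * inner d x \<le> s * (inner d (tilted_mean l) + 2 * s * Q\<^sup>2)"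
      by (simp add: power2_eq_square algebra_simps)
    then show ?thesis using s by simp
  qed
  have "((\<lambda>s. inner d (tilted_mean l) + 2 * s * Q\<^sup>2) \<longlongrightarrow> inner d (tilted_mean l) + 2 * 0 * Q\<^sup>2) (at_right 0)"
    by (intro tendsto_intros)
  moreover have "\<forall>\<^sub>F s in at_right 0. inner d x \<le> inner d (tilted_mean l) + 2 * s * Q\<^sup>2"
    by (rule eventually_at_rightI[of 0 "min 1 (1 / (2 * Q))"]) (use le Q in auto)
  ultimately have "inner d x \<le> inner d (tilted_mean l) + 2 * 0 * Q\<^sup>2"
    by (rule tendsto_lowerbound) simp
  then show ?thesis by simp
qed

lemma closure_hull_subset: "closure (convex hull S) \<subseteq> Rn n"
  by (intro closure_minimal hull_minimal support_subset closed_Rn subspace_imp_convex subspace_Rn)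

lemma compact_closure_hull: "compact (closure (convex hull S))"
proof (rule compact_Rn[OF closure_hull_subset])
  show "bounded (closure (convex hull S))"
    by (intro bounded_closure bounded_convex_hull compact_imp_bounded compact_support)
qed simp

text \<open>Let \<open>z\<close> be the nearest point of the closed hull. The affine function
  \<open>inner (?y - z) (z - w)\<close> of \<open>w\<close> is nonnegative on the support, while its
  tilted integral is minus the squared distance from \<open>?y\<close> to \<open>z\<close>; so
  \<open>?y = z\<close>.\<close>

lemma tilted_mean_in_hull: "tilted_mean l \<in> closure (convex hull S)" (is "?y \<in> ?K")
proof -
  have "?K \<noteq> {}" using support_nonempty by simp
  moreover have "continuous_on ?K (\<lambda>w. dist ?y w)" by (intro continuous_intros)
  ultimately obtain z where z: "z \<in> ?K" "\<And>w. w \<in> ?K \<Longrightarrow> dist ?y z \<le> dist ?y w"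
    using continuous_attains_inf[OF compact_closure_hull] by blast
  have "0 \<le> inner (?y - z) z + inner (z - ?y) w" if "w \<in> S" for w
  proof -
    have "w \<in> ?K" using that by (meson closure_subset hull_inc subsetD)
    then have "inner (?y - z) (w - z) \<le> 0"
      using z by (intro any_closest_point_dot[of ?K]) (auto intro: convex_closure)
    then show ?thesis by (simp add: inner_diff_left inner_diff_right)
  qed
  then have "0 \<le> (\<integral>w. (inner (?y - z) z + inner (z - ?y) w) * exp (inner l w - \<Lambda> l) \<partial>\<mu>)"
    using AE_support by (intro integral_nonneg_AE) (auto elim: eventually_mono)
  also have "\<dots> = inner (?y - z) z + inner (z - ?y) ?y" by (rule integral_tilted_affine)
  also have "\<dots> = - (norm (?y - z))\<^sup>2"
    unfolding power2_norm_eq_inner by (simp add: inner_diff_left inner_diff_right inner_commute)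
  finally have "?y = z" by simp
  then show ?thesis using z by simp
qed

end

section \<open>The mean-field bound\<close>

lemma nn_integral_exp_inner_Rn_vec:
  assumes b: "b \<in> Rn n"
  shows "(\<integral>\<^sup>+u. ennreal (exp (inner b (Rn_vec n u))) \<partial>(\<Pi>\<^sub>M i\<in>{..<n}. std_gauss)) = ennreal (exp ((norm b)\<^sup>2 / 2))"
  using nn_integral_exp_PiM_std_gauss[of "{..<n}" "coord b"] by (simp add: inner_Rn_vec[OF b] norm_sq_Rn[OF b])

text \<open>For \<open>s = 1\<close> the supremum of Gaussian densities dominates a single one, of
  mass 1, so \<open>exp (gaussian_mean_width n W)\<close> is at least 1.\<close>

lemma gaussian_mean_width_nonneg:
  assumes W: "W \<noteq> {}" "W \<subseteq> Rn n" and R: "\<And>w. w \<in> W \<Longrightarrow> norm w \<le> R"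
  shows "0 \<le> gaussian_mean_width n W"
proof -
  let ?P = "\<Pi>\<^sub>M i\<in>{..<n}. std_gauss"
  obtain w where w: "w \<in> W" "w \<in> Rn n" using W by blast
  have "1 = ennreal (exp (- ((norm w)\<^sup>2 / 2))) * (\<integral>\<^sup>+u. ennreal (exp (inner w (Rn_vec n u))) \<partial>?P)"
    by (simp add: nn_integral_exp_inner_Rn_vec[OF w(2)] flip: ennreal_mult exp_add)
  also have "\<dots> = (\<integral>\<^sup>+u. ennreal (exp (- ((norm w)\<^sup>2 / 2))) * ennreal (exp (inner w (Rn_vec n u))) \<partial>?P)"
    by (rule nn_integral_cmult[symmetric]) measurable
  also have "\<dots> = (\<integral>\<^sup>+u. ennreal (exp (inner w (Rn_vec n u) + - ((norm w)\<^sup>2 / 2))) \<partial>?P)"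
    by (intro nn_integral_cong) (simp add: add.commute flip: ennreal_mult exp_add)
  also have "\<dots> \<le> (\<integral>\<^sup>+u. ennreal (exp (SUP w\<in>W. inner w (Rn_vec n u) + - ((norm w)\<^sup>2 / 2))) \<partial>?P)"
    by (intro nn_integral_mono ennreal_leI, subst exp_le_cancel_iff)
      (intro SUP_affine_le[OF R _ w(1), where B=0], auto)
  also have "\<dots> \<le> ennreal (exp (gaussian_mean_width n W))"
    using exp_SUP_le_gaussian_mean_width[OF W R, of 1] by simp
  finally show ?thesis by simp
qed

text \<open>For each fixed \<open>z\<close> the suprema of \<open>inner w z\<close> agree, since a
  closed half-space that contains \<open>V\<close> contains its closed convex hull.\<close>

lemma gaussian_mean_width_closure_hull:
  assumes V: "V \<noteq> {}" "V \<subseteq> Rn n" and R: "\<And>v. v \<in> V \<Longrightarrow> norm v \<le> R"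
  shows "gaussian_mean_width n (closure (convex hull V)) = gaussian_mean_width n V"
proof -
  let ?W = "closure (convex hull V)"
  have sub: "V \<subseteq> ?W" by (meson closure_subset hull_subset order_trans)
  have "(SUP w\<in>?W. inner w z) = (SUP v\<in>V. inner v z)" for z
  proof -
    define B where "B = (SUP v\<in>V. inner v z)"
    have "inner z v \<le> B" if "v \<in> V" for v
      unfolding B_def inner_commute[of z v]
      using SUP_affine_le[of V R "\<lambda>_. 0" 0, OF R _ that, of z] by simp
    then have "V \<subseteq> {w. inner z w \<le> B}" by blast
    then have "?W \<subseteq> {w. inner z w \<le> B}"
      by (intro closure_minimal hull_minimal convex_halfspace_le closed_halfspace_le)
    then have le: "inner w z \<le> (SUP v\<in>V. inner v z)" if "w \<in> ?W" for w
      unfolding B_def[symmetric] inner_commute[of w z] using that by blast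
    show ?thesis
    proof (rule antisym)
      show "(SUP w\<in>?W. inner w z) \<le> (SUP v\<in>V. inner v z)"
        using V sub le by (intro cSUP_least) auto
      show "(SUP v\<in>V. inner v z) \<le> (SUP w\<in>?W. inner w z)"
        using V sub le by (intro cSUP_subset_mono bdd_aboveI2) auto
    qed
  qed
  then show ?thesis by (simp add: gaussian_mean_width_def)
qed

context compact_prob_Rn
begin

text \<open>The one-dimensional mean value theorem on the segment from \<open>y\<close> to
  \<open>x\<close>. Convexity keeps the segment in \<open>C\<close>, hence in \<open>Rn n\<close>,
  where the derivative of \<open>f\<close> is taken.\<close>

lemma gradient_mean_value:
  assumes C1: "C1_with_gradient n f F" and C: "convex C" "C \<subseteq> Rn n" and xy: "x \<in> C" "y \<in> C"
  obtains z where "z \<in> C" "f x - f y = inner (F z) (x - y)"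
proof -
  define p where "p r = y + r *\<^sub>R (x - y)" for r :: real
  have p_in: "p r \<in> C" if "r \<in> {0..1}" for r
  proof -
    have "p r = (1 - r) *\<^sub>R y + r *\<^sub>R x" by (simp add: p_def algebra_simps)
    then show ?thesis using that C(1) xy by (simp add: convexD)
  qed
  have "((\<lambda>r. f (p r)) has_derivative (\<lambda>t. inner (F (p r)) (t *\<^sub>R (x - y)))) (at r within {0..1})"
    if r: "r \<in> {0..1}" for r
  proof (rule has_derivative_in_compose2[where t = "Rn n" and g = f and g' = "\<lambda>z h. inner (F z) h"])
    show "(f has_derivative (\<lambda>h. inner (F z) h)) (at z within Rn n)" if "z \<in> Rn n" for z
      using C1 that by (auto simp: C1_with_gradient_def)
    show "p ` {0..1} \<subseteq> Rn n" using p_in C(2) by auto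
    show "(p has_derivative (\<lambda>t. t *\<^sub>R (x - y))) (at r within {0..1})"
      unfolding p_def by (auto intro!: derivative_eq_intros)
  qed (use r in auto)
  then obtain r where r: "r \<in> {0..1}" "f (p 1) - f (p 0) = inner (F (p r)) ((1 - 0) *\<^sub>R (x - y))"
    using mvt_very_simple[of 0 1 "\<lambda>r. f (p r)" "\<lambda>r t. inner (F (p r)) (t *\<^sub>R (x - y))"] by auto
  show ?thesis
    by (rule that[OF p_in[OF r(1)]]) (use r(2) in \<open>simp add: p_def\<close>)
qed

text \<open>\<open>M\<close> bounds \<open>f\<close> minus the Legendre transform where the latter
  is finite; this is applied at the tilted mean of the maximiser \<open>l\<close>, where the
  transform is explicit.\<close>

lemma mean_field_selection:
  assumes C1: "C1_with_gradient n f F" and x: "x \<in> S"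
    and W: "compact W" "convex W" "W \<noteq> {}" "W \<subseteq> Rn n" "F ` closure (convex hull S) \<subseteq> W"
    and M: "\<And>y r. y \<in> Rn n \<Longrightarrow> legendre n \<Lambda> y = ereal r \<Longrightarrow> f y - r \<le> M"
  obtains l where "l \<in> W" "f x \<le> M + (inner l x - \<Lambda> l)"
proof -
  let ?K = "closure (convex hull S)"
  have "continuous_on W (\<lambda>l. inner l x - \<Lambda> l)"
    by (intro continuous_intros continuous_on_subset[OF continuous_on_log_laplace]) simp
  then obtain l where l: "l \<in> W" "\<And>w. w \<in> W \<Longrightarrow> inner w x - \<Lambda> w \<le> inner l x - \<Lambda> l"
    using continuous_attains_sup[OF W(1,3)] by blast
  define y where "y = tilted_mean l"
  have le: "inner w (x - y) \<le> inner l (x - y)" if w: "w \<in> W" for w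
  proof -
    \<comment> \<open>First order condition at \<open>l\<close> towards \<open>w\<close>; by
      convexity the segment between them stays in \<open>W\<close>.\<close>
    have "inner (w - l) x \<le> inner (w - l) y"
      unfolding y_def
    proof (rule tilted_mean_first_order)
      fix s :: real assume s: "0 \<le> s" "s \<le> 1"
      have "l + s *\<^sub>R (w - l) = (1 - s) *\<^sub>R l + s *\<^sub>R w" by (simp add: algebra_simps)
      also have "\<dots> \<in> W" using s w l(1) W(2) by (simp add: convexD)
      finally show "inner (l + s *\<^sub>R (w - l)) x - \<Lambda> (l + s *\<^sub>R (w - l)) \<le> inner l x - \<Lambda> l" by (rule l(2))
    qed
    then show ?thesis by (simp add: inner_diff_left inner_diff_right)
  qed
  have K: "convex ?K" "?K \<subseteq> Rn n"
    by (simp_all add: convex_closure closure_hull_subset)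
  have "x \<in> ?K" using x by (meson closure_subset hull_inc subsetD)
  then obtain z where z: "z \<in> ?K" "f x - f y = inner (F z) (x - y)"
    using gradient_mean_value[OF C1 K] tilted_mean_in_hull[of l] unfolding y_def by blast
  \<comment> \<open>The gradient at \<open>z\<close> belongs to \<open>W\<close>, so it can be
    compared with \<open>l\<close>.\<close>
  have "f x - f y \<le> inner l (x - y)"
    unfolding z(2) using z(1) W(5) by (intro le) blast
  moreover have "f y - (inner l y - \<Lambda> l) \<le> M"
    using l(1) W(4) unfolding y_def by (intro M tilted_mean_in_Rn legendre_tilted_mean) blast
  ultimately have "f x \<le> M + (inner l x - \<Lambda> l)" by (simp add: inner_diff_right)
  then show ?thesis using l(1) that by blast
qed

section \<open>Replacing the selected tilt by a Gaussian average\<close>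

text \<open>The right side is the average of \<open>exp (inner v x - \<Lambda> v)\<close> over a
  Gaussian \<open>v\<close> of variance \<open>s\<^sup>2\<close> around \<open>l\<close>. The
  average of the reciprocal is estimated by Fubini and the Gaussian moment generating function;
  convexity of the reciprocal then gives the lower bound.\<close>

lemma exp_tilt_le_gaussian_average:
  assumes x: "x \<in> S" and l: "l \<in> Rn n" and s: "0 < s" and D: "\<And>w. w \<in> S \<Longrightarrow> norm (w - x) \<le> D"
  shows "ennreal (exp (inner l x - \<Lambda> l - s\<^sup>2 * D\<^sup>2 / 2)) \<le>
    (\<integral>\<^sup>+u. ennreal (exp (inner (s *\<^sub>R Rn_vec n u) x - \<Lambda> (s *\<^sub>R Rn_vec n u)) *
      exp (inner l (Rn_vec n u /\<^sub>R s) + - ((norm l)\<^sup>2 / (2 * s\<^sup>2)))) \<partial>(\<Pi>\<^sub>M i\<in>{..<n}. std_gauss))"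
proof -
  let ?P = "\<Pi>\<^sub>M i\<in>{..<n}. std_gauss"
  interpret P: prob_space ?P
    by (rule prob_space_PiM) (rule std_gauss.prob_space_axioms)
  interpret pair_sigma_finite ?P \<mu> by unfold_locales
  \<comment> \<open>In the variable \<open>u\<close> the Gaussian is standard and shifted by
    \<open>a\<close>. Here \<open>q\<close> is its density relative to the unshifted one,
    \<open>G\<close> the reciprocal of the averaged function, and \<open>c\<close> the claimed lower
    bound.\<close>
  define a where "a = l /\<^sub>R s"
  define q where "q z = exp (inner l (z /\<^sub>R s) + - ((norm l)\<^sup>2 / (2 * s\<^sup>2)))" for z
  define G where "G z = exp (\<Lambda> (s *\<^sub>R z) - inner (s *\<^sub>R z) x)" for z
  define c where "c = exp (inner l x - \<Lambda> l - s\<^sup>2 * D\<^sup>2 / 2)"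
  have a: "a \<in> Rn n" using l by (simp add: a_def subspace_scale[OF subspace_Rn])
  have q_eq: "q z = exp (inner a z - (norm a)\<^sup>2 / 2)" for z
    using s by (simp add: q_def a_def power_mult_distrib power_inverse field_simps)
  have [measurable]: "q \<in> borel_measurable borel" "G \<in> borel_measurable borel"
    unfolding q_def[abs_def] G_def[abs_def] by measurable
  have mgf: "(\<integral>\<^sup>+u. ennreal (exp (inner b (Rn_vec n u) - r)) \<partial>?P) = ennreal (exp ((norm b)\<^sup>2 / 2 - r))"
    if "b \<in> Rn n" for b r
  proof -
    have "(\<integral>\<^sup>+u. ennreal (exp (inner b (Rn_vec n u) - r)) \<partial>?P)
        = (\<integral>\<^sup>+u. ennreal (exp (- r)) * ennreal (exp (inner b (Rn_vec n u))) \<partial>?P)"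
      by (intro nn_integral_cong) (simp flip: ennreal_mult exp_add)
    also have "\<dots> = ennreal (exp (- r)) * ennreal (exp ((norm b)\<^sup>2 / 2))"
      by (subst nn_integral_cmult) (auto simp: nn_integral_exp_inner_Rn_vec[OF that])
    finally show ?thesis by (simp flip: ennreal_mult exp_add)
  qed
  have q_int: "(\<integral>\<^sup>+u. ennreal (q (Rn_vec n u)) \<partial>?P) = 1"
    unfolding q_eq mgf[OF a] by simp
  \<comment> \<open>Writing the Laplace transform inside \<open>G\<close> as an integral over
    \<open>\<mu>\<close> leaves exponentials of affine functions of \<open>z\<close>, whose Gaussian
    integrals are explicit.\<close>
  have Gq_eq: "ennreal (G z * q z) =
      (\<integral>\<^sup>+w. ennreal (exp (inner (s *\<^sub>R (w - x) + a) z - (norm a)\<^sup>2 / 2)) \<partial>\<mu>)" for z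
  proof -
    let ?k = "exp (- inner (s *\<^sub>R z) x) * q z"
    have "ennreal (G z * q z) = ennreal ?k * (\<integral>\<^sup>+w. ennreal (exp (inner (s *\<^sub>R z) w)) \<partial>\<mu>)"
      unfolding nn_integral_exp_inner by (simp add: G_def q_def exp_diff exp_minus field_simps flip: ennreal_mult)
    also have "\<dots> = (\<integral>\<^sup>+w. ennreal ?k * ennreal (exp (inner (s *\<^sub>R z) w)) \<partial>\<mu>)"
      by (rule nn_integral_cmult[symmetric]) measurable
    also have "\<dots> = (\<integral>\<^sup>+w. ennreal (exp (inner (s *\<^sub>R (w - x) + a) z - (norm a)\<^sup>2 / 2)) \<partial>\<mu>)"
      by (intro nn_integral_cong)
        (simp add: q_eq inner_add_left inner_diff_left inner_diff_right inner_commute algebra_simps flip: ennreal_mult exp_add)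
    finally show ?thesis .
  qed
  have "(\<integral>\<^sup>+u. ennreal (G (Rn_vec n u) * q (Rn_vec n u)) \<partial>?P)
      = (\<integral>\<^sup>+w. (\<integral>\<^sup>+u. ennreal (exp (inner (s *\<^sub>R (w - x) + a) (Rn_vec n u) - (norm a)\<^sup>2 / 2)) \<partial>?P) \<partial>\<mu>)"
    unfolding Gq_eq by (rule Fubini'[symmetric]) measurable
  also have "\<dots> \<le> (\<integral>\<^sup>+w. ennreal (exp (s\<^sup>2 * D\<^sup>2 / 2 - inner l x)) * ennreal (exp (inner l w)) \<partial>\<mu>)"
  proof (rule nn_integral_mono_AE)
    show "AE w in \<mu>. (\<integral>\<^sup>+u. ennreal (exp (inner (s *\<^sub>R (w - x) + a) (Rn_vec n u) - (norm a)\<^sup>2 / 2)) \<partial>?P)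
        \<le> ennreal (exp (s\<^sup>2 * D\<^sup>2 / 2 - inner l x)) * ennreal (exp (inner l w))"
      using AE_support
    proof eventually_elim
      case (elim w)
      have b: "s *\<^sub>R (w - x) + a \<in> Rn n"
        using elim x a support_subset
        by (intro subspace_add[OF subspace_Rn] subspace_scale[OF subspace_Rn] subspace_diff[OF subspace_Rn]) auto
      \<comment> \<open>Completing the square. As \<open>s *\<^sub>R a = l\<close>, the cross term
        at \<open>v = w - x\<close> is \<open>inner l w - inner l x\<close>, and \<open>D\<close>
        bounds the quadratic term.\<close>
      have "(norm (s *\<^sub>R v + a))\<^sup>2 / 2 - (norm a)\<^sup>2 / 2 = s\<^sup>2 * (norm v)\<^sup>2 / 2 + s * inner v a" for v
        unfolding power2_norm_eq_inner
        by (simp add: inner_add_left inner_add_right inner_commute power2_eq_square field_simps)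
      from this[of "w - x"]
      have "(norm (s *\<^sub>R (w - x) + a))\<^sup>2 / 2 - (norm a)\<^sup>2 / 2 = s\<^sup>2 * (norm (w - x))\<^sup>2 / 2 + s * inner (w - x) a" .
      also have "s * inner (w - x) a = inner l w - inner l x"
        using s by (simp add: a_def inner_commute[of _ l] inner_diff_right mult.assoc[symmetric])
      also have "s\<^sup>2 * (norm (w - x))\<^sup>2 / 2 \<le> s\<^sup>2 * D\<^sup>2 / 2"
        using D[OF elim] by (intro divide_right_mono mult_left_mono power_mono) auto
      finally have "exp ((norm (s *\<^sub>R (w - x) + a))\<^sup>2 / 2 - (norm a)\<^sup>2 / 2)
          \<le> exp (s\<^sup>2 * D\<^sup>2 / 2 - inner l x + inner l w)" by simp
      then show ?case unfolding mgf[OF b] by (simp add: ennreal_leI flip: ennreal_mult exp_add)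
    qed
  qed
  also have "\<dots> = ennreal (exp (s\<^sup>2 * D\<^sup>2 / 2 - inner l x)) * ennreal (exp (\<Lambda> l))"
    by (subst nn_integral_cmult) (auto simp: nn_integral_exp_inner)
  also have "\<dots> = ennreal (1 / c)"
  proof -
    have "s\<^sup>2 * D\<^sup>2 / 2 - inner l x + \<Lambda> l = - (inner l x - \<Lambda> l - s\<^sup>2 * D\<^sup>2 / 2)" by linarith
    then have "exp (s\<^sup>2 * D\<^sup>2 / 2 - inner l x) * exp (\<Lambda> l) = 1 / c"
      unfolding exp_add[symmetric] c_def by (simp only: exp_minus inverse_eq_divide)
    then show ?thesis by (simp flip: ennreal_mult)
  qed
  finally have Gq: "(\<integral>\<^sup>+u. ennreal (G (Rn_vec n u) * q (Rn_vec n u)) \<partial>?P) \<le> ennreal (1 / c)" .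
  \<comment> \<open>\<open>2 c \<le> 1 / G + c\<^sup>2 G\<close> replaces Jensen's inequality for \<open>1 / G\<close>.\<close>
  have pos: "0 < G z" "0 < q z" "0 < c" for z by (simp_all add: G_def q_def c_def)
  have "2 * c * q z \<le> 1 / G z * q z + c\<^sup>2 * (G z * q z)" for z
  proof -
    have "0 \<le> (1 - c * G z)\<^sup>2 / G z * q z" using pos by (simp add: less_imp_le)
    also have "\<dots> = 1 / G z * q z + c\<^sup>2 * (G z * q z) - 2 * c * q z"
      using pos(1)[of z] by (simp add: power2_eq_square field_simps)
    finally show ?thesis by simp
  qed
  then have "(\<integral>\<^sup>+u. ennreal (2 * c) * ennreal (q (Rn_vec n u)) \<partial>?P)
      \<le> (\<integral>\<^sup>+u. ennreal (1 / G (Rn_vec n u) * q (Rn_vec n u)) +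
          ennreal (c\<^sup>2) * ennreal (G (Rn_vec n u) * q (Rn_vec n u)) \<partial>?P)"
    using pos by (intro nn_integral_mono)
      (simp add: less_imp_le ennreal_leI flip: ennreal_mult ennreal_plus)
  also have "\<dots> = (\<integral>\<^sup>+u. ennreal (1 / G (Rn_vec n u) * q (Rn_vec n u)) \<partial>?P) +
      ennreal (c\<^sup>2) * (\<integral>\<^sup>+u. ennreal (G (Rn_vec n u) * q (Rn_vec n u)) \<partial>?P)"
    by (subst nn_integral_add) (auto simp: nn_integral_cmult)
  also have "\<dots> \<le> (\<integral>\<^sup>+u. ennreal (1 / G (Rn_vec n u) * q (Rn_vec n u)) \<partial>?P) + ennreal (c\<^sup>2) * ennreal (1 / c)"
    using Gq by (intro add_left_mono mult_left_mono) auto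
  also have "ennreal (c\<^sup>2) * ennreal (1 / c) = ennreal c"
    using pos(3) by (simp add: power2_eq_square flip: ennreal_mult)
  also have "(\<integral>\<^sup>+u. ennreal (2 * c) * ennreal (q (Rn_vec n u)) \<partial>?P) = ennreal c + ennreal c"
    using pos(3) by (subst nn_integral_cmult) (auto simp: q_int simp flip: ennreal_plus)
  finally have "ennreal c \<le> (\<integral>\<^sup>+u. ennreal (1 / G (Rn_vec n u) * q (Rn_vec n u)) \<partial>?P)"
    by (simp add: ennreal_add_left_cancel_le add.commute)
  moreover have "1 / G z * q z = exp (inner (s *\<^sub>R z) x - \<Lambda> (s *\<^sub>R z)) * q z" for z
    by (simp add: G_def exp_diff)
  ultimately show ?thesis by (simp add: c_def q_def)
qed

text \<open>The tilt selected for \<open>x\<close> determines the centre of a Gaussian density,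
  which the supremum over \<open>W\<close> dominates. The resulting weight does not depend on
  \<open>x\<close>, so the integration over \<open>\<mu>\<close> can be carried out first.\<close>

lemma nn_integral_exp_le_mean_width:
  assumes C1: "C1_with_gradient n f F"
    and W: "compact W" "convex W" "W \<noteq> {}" "W \<subseteq> Rn n" "F ` closure (convex hull S) \<subseteq> W"
    and M: "\<And>y r. y \<in> Rn n \<Longrightarrow> legendre n \<Lambda> y = ereal r \<Longrightarrow> f y - r \<le> M"
    and s: "0 < s" and D: "\<And>x w. x \<in> S \<Longrightarrow> w \<in> S \<Longrightarrow> norm (w - x) \<le> D"
  shows "(\<integral>\<^sup>+x. ennreal (exp (f x)) \<partial>\<mu>) \<le> ennreal (exp (M + s\<^sup>2 * D\<^sup>2 / 2 + gaussian_mean_width n W / s))"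
proof -
  let ?P = "\<Pi>\<^sub>M i\<in>{..<n}. std_gauss"
  interpret P: prob_space ?P
    by (rule prob_space_PiM) (rule std_gauss.prob_space_axioms)
  interpret pair_sigma_finite ?P \<mu> by unfold_locales
  obtain R where R: "\<And>w. w \<in> W \<Longrightarrow> norm w \<le> R"
    using compact_imp_bounded[OF W(1)] by (auto simp: bounded_iff)
  define Q where "Q z = (SUP w\<in>W. inner w z + - ((norm w)\<^sup>2 / (2 * s\<^sup>2)))" for z
  have [measurable]: "Q \<in> borel_measurable borel"
    unfolding Q_def[abs_def]
    by (intro borel_measurable_continuous_onI continuous_on_SUP_affine[where R=R and B=0] W R) auto
  have Q_ge: "inner w z + - ((norm w)\<^sup>2 / (2 * s\<^sup>2)) \<le> Q z" if "w \<in> W" for w z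
    unfolding Q_def by (rule SUP_affine_le[OF R _ that, where B=0]) auto
  define E where "E x u = exp (inner (s *\<^sub>R Rn_vec n u) x - \<Lambda> (s *\<^sub>R Rn_vec n u))" for x u
  define k where "k = exp (M + s\<^sup>2 * D\<^sup>2 / 2)"
  have "(\<integral>\<^sup>+x. ennreal (exp (f x)) \<partial>\<mu>)
      \<le> (\<integral>\<^sup>+x. (\<integral>\<^sup>+u. ennreal k * ennreal (E x u * exp (Q (Rn_vec n u /\<^sub>R s))) \<partial>?P) \<partial>\<mu>)"
  proof (rule nn_integral_mono_AE)
    show "AE x in \<mu>. ennreal (exp (f x)) \<le> (\<integral>\<^sup>+u. ennreal k * ennreal (E x u * exp (Q (Rn_vec n u /\<^sub>R s))) \<partial>?P)"
      using AE_support
    proof eventually_elim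
      case (elim x)
      obtain l where l: "l \<in> W" "f x \<le> M + (inner l x - \<Lambda> l)"
        by (rule mean_field_selection[OF C1 elim W M])
      have "ennreal (exp (f x)) \<le> ennreal (k * exp (inner l x - \<Lambda> l - s\<^sup>2 * D\<^sup>2 / 2))"
        using l(2) by (intro ennreal_leI) (simp add: k_def flip: exp_add)
      also have "\<dots> = ennreal k * ennreal (exp (inner l x - \<Lambda> l - s\<^sup>2 * D\<^sup>2 / 2))"
        by (simp add: k_def ennreal_mult)
      also have "\<dots> \<le> ennreal k * (\<integral>\<^sup>+u. ennreal (E x u * exp (inner l (Rn_vec n u /\<^sub>R s) + - ((norm l)\<^sup>2 / (2 * s\<^sup>2)))) \<partial>?P)"
        unfolding E_def using l(1) W(4) D[OF elim]
        by (intro mult_left_mono exp_tilt_le_gaussian_average elim s) auto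
      also have "\<dots> \<le> ennreal k * (\<integral>\<^sup>+u. ennreal (E x u * exp (Q (Rn_vec n u /\<^sub>R s))) \<partial>?P)"
        by (intro mult_left_mono nn_integral_mono ennreal_leI exp_le_cancel_iff[THEN iffD2] Q_ge l(1))
          (auto simp: E_def)
      also have "\<dots> = (\<integral>\<^sup>+u. ennreal k * ennreal (E x u * exp (Q (Rn_vec n u /\<^sub>R s))) \<partial>?P)"
        unfolding E_def by (rule nn_integral_cmult[symmetric]) measurable
      finally show ?case .
    qed
  qed
  also have "\<dots> = (\<integral>\<^sup>+u. (\<integral>\<^sup>+x. ennreal k * ennreal (E x u * exp (Q (Rn_vec n u /\<^sub>R s))) \<partial>\<mu>) \<partial>?P)"
    unfolding E_def by (rule Fubini') measurable
  \<comment> \<open>For fixed \<open>u\<close> the function \<open>E x u\<close> of \<open>x\<close>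
    has integral 1 over \<open>\<mu>\<close>.\<close>
  also have "\<dots> = (\<integral>\<^sup>+u. ennreal k * ennreal (exp (Q (Rn_vec n u /\<^sub>R s))) \<partial>?P)"
  proof (rule nn_integral_cong)
    fix u
    let ?t = "s *\<^sub>R Rn_vec n u"
    let ?j = "k * exp (Q (Rn_vec n u /\<^sub>R s)) * exp (- \<Lambda> ?t)"
    have "(\<integral>\<^sup>+x. ennreal k * ennreal (E x u * exp (Q (Rn_vec n u /\<^sub>R s))) \<partial>\<mu>)
        = (\<integral>\<^sup>+x. ennreal ?j * ennreal (exp (inner ?t x)) \<partial>\<mu>)"
      by (intro nn_integral_cong) (simp add: E_def k_def exp_diff exp_minus field_simps flip: ennreal_mult)
    also have "\<dots> = ennreal ?j * ennreal (exp (\<Lambda> ?t))"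
      by (subst nn_integral_cmult) (auto simp: nn_integral_exp_inner simp del: inner_scaleR_left)
    also have "\<dots> = ennreal k * ennreal (exp (Q (Rn_vec n u /\<^sub>R s)))"
      by (simp add: k_def exp_minus flip: ennreal_mult)
    finally show "(\<integral>\<^sup>+x. ennreal k * ennreal (E x u * exp (Q (Rn_vec n u /\<^sub>R s))) \<partial>\<mu>)
        = ennreal k * ennreal (exp (Q (Rn_vec n u /\<^sub>R s)))" .
  qed
  also have "\<dots> = ennreal k * (\<integral>\<^sup>+u. ennreal (exp (Q (Rn_vec n u /\<^sub>R s))) \<partial>?P)"
    by (rule nn_integral_cmult) measurable
  also have "\<dots> \<le> ennreal k * ennreal (exp (gaussian_mean_width n W / s))"
    unfolding Q_def by (intro mult_left_mono exp_SUP_le_gaussian_mean_width[OF W(3,4) R s]) auto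
  also have "\<dots> = ennreal (exp (M + s\<^sup>2 * D\<^sup>2 / 2 + gaussian_mean_width n W / s))"
    by (simp add: k_def flip: ennreal_mult exp_add)
  finally show ?thesis .
qed

text \<open>\<open>V\<close> is the image of the hull itself; by continuity the gradient maps the
  closed hull into the closure of \<open>V\<close>. So the bound applies with the closed convex hull
  \<open>W\<close> of \<open>V\<close>, of equal mean width. The scale \<open>s\<close> stays
  free.\<close>

lemma ln_integral_exp_le:
  assumes C1: "C1_with_gradient n f F" and V: "V = F ` (convex hull S)"
    and M: "\<And>y r. y \<in> Rn n \<Longrightarrow> legendre n \<Lambda> y = ereal r \<Longrightarrow> f y - r \<le> M"
  shows "0 \<le> gaussian_mean_width n V"
    and "0 < s \<Longrightarrow> ln (\<integral>x. exp (f x) \<partial>\<mu>) \<le> M + s\<^sup>2 * (diameter (convex hull S))\<^sup>2 / 2 + gaussian_mean_width n V / s"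
proof -
  let ?K = "convex hull S"
  define W where "W = closure (convex hull V)"
  have contF: "continuous_on (Rn n) F" and F_in: "\<And>x. x \<in> Rn n \<Longrightarrow> F x \<in> Rn n"
    and deriv: "\<And>x. x \<in> Rn n \<Longrightarrow> (f has_derivative (\<lambda>h. inner (F x) h)) (at x within Rn n)"
    using C1 by (auto simp: C1_with_gradient_def)
  have contK: "continuous_on (closure ?K) F"
    by (rule continuous_on_subset[OF contF closure_hull_subset])
  have V_sub: "V \<subseteq> F ` closure ?K" using closure_subset by (auto simp: V)
  have V_ne: "V \<noteq> {}" using support_nonempty by (simp add: V)
  have V_Rn: "V \<subseteq> Rn n" using V_sub closure_hull_subset F_in by blast
  have bV: "bounded V"
    using compact_imp_bounded[OF compact_continuous_image[OF contK compact_closure_hull]] V_sub bounded_subset by blast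
  then obtain R where R: "\<And>v. v \<in> V \<Longrightarrow> norm v \<le> R" by (auto simp: bounded_iff)
  have W_Rn: "W \<subseteq> Rn n"
    unfolding W_def by (intro closure_minimal hull_minimal V_Rn closed_Rn subspace_imp_convex subspace_Rn)
  have "compact W"
    by (rule compact_Rn[OF W_Rn]) (simp_all add: W_def bV bounded_closure bounded_convex_hull)
  moreover have "convex W" "W \<noteq> {}" using V_ne by (auto simp: W_def convex_closure)
  moreover have "F ` closure ?K \<subseteq> W"
  proof -
    have "V \<subseteq> W" unfolding W_def by (meson closure_subset hull_subset order_trans)
    then show ?thesis
      unfolding V by (intro image_closure_subset[OF contK]) (auto simp: W_def)
  qed
  moreover have "norm (w - x) \<le> diameter ?K" if "x \<in> S" "w \<in> S" for x w
    using diameter_bounded_bound[OF bounded_convex_hull[OF compact_imp_bounded[OF compact_support]]] that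
    by (metis dist_norm hull_inc)
  ultimately have le: "(\<integral>\<^sup>+x. ennreal (exp (f x)) \<partial>\<mu>)
      \<le> ennreal (exp (M + s\<^sup>2 * (diameter ?K)\<^sup>2 / 2 + gaussian_mean_width n W / s))" if "0 < s" for s
    using that W_Rn by (intro nn_integral_exp_le_mean_width[OF C1] M)
  have gW: "gaussian_mean_width n W = gaussian_mean_width n V"
    unfolding W_def by (rule gaussian_mean_width_closure_hull[OF V_ne V_Rn R])
  show "0 \<le> gaussian_mean_width n V" by (rule gaussian_mean_width_nonneg[OF V_ne V_Rn R])
  have contf: "continuous_on (Rn n) f"
    using deriv has_derivative_continuous by (force simp: continuous_on_eq_continuous_within)
  assume "0 < s"
  have "(\<integral>x. exp (f x) \<partial>\<mu>) \<le> exp (M + s\<^sup>2 * (diameter ?K)\<^sup>2 / 2 + gaussian_mean_width n V / s)"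
    using le[OF \<open>0 < s\<close>] integrable_continuous[OF continuous_on_exp[OF contf]]
    by (simp add: nn_integral_eq_integral gW)
  then show "ln (\<integral>x. exp (f x) \<partial>\<mu>) \<le> M + s\<^sup>2 * (diameter ?K)\<^sup>2 / 2 + gaussian_mean_width n V / s"
    using ln_le_cancel_iff[OF integral_exp_pos[OF contf] exp_gt_zero] by simp
qed

end

section \<open>Choice of the scale and conclusion\<close>

text \<open>For positive \<open>g\<close> the minimum is at \<open>s = (g / n) powr (1 / 3)\<close>,
  where the two terms are 1/2 and 1 times \<open>n powr (1 / 3) * g powr (2 / 3)\<close>. For
  \<open>g = 0\<close> there is no minimiser and \<open>s\<close> tends to 0.\<close>

lemma optimize_scale:
  fixes a M g n :: real
  assumes n: "0 < n" and g: "0 \<le> g" and le: "\<And>s. 0 < s \<Longrightarrow> a \<le> M + s\<^sup>2 * n / 2 + g / s"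
  shows "a \<le> M + 3 / 2 * n powr (1 / 3) * g powr (2 / 3)"
proof (cases "g = 0")
  case True
  have "((\<lambda>s. M + s\<^sup>2 * n / 2) \<longlongrightarrow> M + 0\<^sup>2 * n / 2) (at_right 0)"
    by (intro tendsto_intros) auto
  moreover have "\<forall>\<^sub>F s in at_right 0. a \<le> M + s\<^sup>2 * n / 2"
    by (rule eventually_at_rightI[of 0 1]) (use le True in auto)
  ultimately have "a \<le> M + 0\<^sup>2 * n / 2" by (rule tendsto_lowerbound) simp
  then show ?thesis using True by simp
next
  case False
  define p q where "p = n powr (1 / 3)" and "q = g powr (1 / 3)"
  have pq: "0 < p" "0 < q" using n g False by (auto simp: p_def q_def)
  have p3: "n = p ^ 3" and q3: "g = q ^ 3" and q2: "g powr (2 / 3) = q\<^sup>2"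
    using n g False by (simp_all add: p_def q_def powr_powr flip: powr_realpow)
  have "a \<le> M + (q / p)\<^sup>2 * n / 2 + g / (q / p)" using pq by (intro le) simp
  also have "(q / p)\<^sup>2 * n / 2 = 1 / 2 * p * q\<^sup>2"
    unfolding p3 using pq by (simp add: field_simps power2_eq_square power3_eq_cube)
  also have "g / (q / p) = p * q\<^sup>2"
    unfolding q3 using pq by (simp add: field_simps power2_eq_square power3_eq_cube)
  finally show ?thesis unfolding q2 p_def[symmetric] by simp
qed

theorem corollary1p2:
  shows "\<exists>\<kappa>::real. \<kappa> > 0 \<and>
    (\<forall>(n::nat) (\<mu>::fseq measure) (f::fseq \<Rightarrow> real) (gradf::fseq \<Rightarrow> fseq) (K::fseq set) (V::fseq set).
      n \<ge> 1 \<longrightarrow>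
      prob_space \<mu> \<longrightarrow>
      sets \<mu> = sets (restrict_space borel (Rn n)) \<longrightarrow>
      compact (measure_support \<mu>) \<longrightarrow>
      \<not> (\<exists>a\<in>Rn n. \<exists>b::real. a \<noteq> 0 \<and> measure_support \<mu> \<subseteq> {x. inner a x = b}) \<longrightarrow>
      K = convex hull (measure_support \<mu>) \<longrightarrow>
      diameter K = sqrt (real n) \<longrightarrow>
      C1_with_gradient n f gradf \<longrightarrow>
      V = gradf ` K \<longrightarrow>
      ereal (ln (\<integral>x. exp (f x) \<partial>\<mu>))
        \<le> (SUP y\<in>Rn n. ereal (f y) - legendre n (log_laplace \<mu>) y)
          + ereal (\<kappa> * real n powr (1/3) * gaussian_mean_width n V powr (2/3)))"
proof (intro exI[of _ "3 / 2"] conjI allI impI)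
  fix n :: nat and \<mu> :: "fseq measure" and f :: "fseq \<Rightarrow> real" and gradf :: "fseq \<Rightarrow> fseq"
    and K V :: "fseq set"
  assume n: "1 \<le> n" and prob: "prob_space \<mu>"
    and sets: "sets \<mu> = sets (restrict_space borel (Rn n))"
    and comp: "compact (measure_support \<mu>)" and K: "K = convex hull (measure_support \<mu>)"
    and diam: "diameter K = sqrt (real n)" and C1: "C1_with_gradient n f gradf" and V: "V = gradf ` K"
  interpret compact_prob_Rn \<mu> n
    using prob sets comp by (simp add: compact_prob_Rn_def compact_prob_Rn_axioms_def)
  let ?\<Phi> = "SUP y\<in>Rn n. ereal (f y) - legendre n (log_laplace \<mu>) y"
  let ?e = "3 / 2 * real n powr (1/3) * gaussian_mean_width n V powr (2/3)"
  have upper: "ereal (f y - r) \<le> ?\<Phi>" if "y \<in> Rn n" "legendre n (log_laplace \<mu>) y = ereal r" for y r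
    using SUP_upper[OF that(1), of "\<lambda>y. ereal (f y) - legendre n (log_laplace \<mu>) y"] that(2) by simp
  \<comment> \<open>The tilted mean of 0 has a finite transform, which excludes the value minus
    infinity. For plus infinity the bound is trivial, so only a real supremum \<open>M\<close>
    remains.\<close>
  have "0 \<in> Rn n" by (rule subspace_0[OF subspace_Rn])
  then have not_minf: "?\<Phi> \<noteq> - \<infinity>"
    using upper[OF tilted_mean_in_Rn legendre_tilted_mean] by force
  show "ereal (ln (\<integral>x. exp (f x) \<partial>\<mu>)) \<le> ?\<Phi> + ereal ?e"
  proof (cases ?\<Phi>)
    case (real M)
    have M: "f y - r \<le> M" if "y \<in> Rn n" "legendre n (log_laplace \<mu>) y = ereal r" for y r
      using upper[OF that] real by simp
    note V' = V[unfolded K]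
    have "ln (\<integral>x. exp (f x) \<partial>\<mu>) \<le> M + s\<^sup>2 * real n / 2 + gaussian_mean_width n V / s" if "0 < s" for s
      using ln_integral_exp_le(2)[OF C1 V' M that] diam by (simp add: K)
    then have "ln (\<integral>x. exp (f x) \<partial>\<mu>) \<le> M + ?e"
      using n ln_integral_exp_le(1)[OF C1 V' M] by (intro optimize_scale) auto
    then show ?thesis using real by simp
  qed (use not_minf in auto)
qed simp

end
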